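(* Let $C$ be a symmetric $p\times p$ matrix, let $\mathcal X\subset\mathbf R^p$ be a spectratope $$ \mathcal X=\{x\in\mathbf R^p:\exists (y\in\mathbf R^n,t\in\mathcal T): x=Py,\;R_k^2[y]\preceq t_kI_{d_k},\,1\le k\le K\}, $$ let $\mathrm{Opt}=\max_{x\in\mathcal X}x^TCx$, and let $$ \mathrm{Opt}_*=\min_{\Lambda=\{\Lambda_k\in\mathbf S^{d_k}\}_{k\le K}}\Big\{\phi_{\mathcal T}(\lambda[\Lambda]):\ \Lambda_k\succeq0,\,k\le K,\ P^TCP\preceq\sum_k\mathcal R_k^*[\Lambda_k]\Big\}. $$ Then the latter optimization problem is solvable (the minimum is attained), and $$ \mathrm{Opt}\le\mathrm{Opt}_*\le 2\max[\ln(2D),1]\,\mathrm{Opt}, $$ where $D=\sum_{k=1}^Kd_k$ is the size of the spectratope $\mathcal X$.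
   Context: $\mathbf S^k$ is the space of symmetric $k\times k$ matrices; $U\succeq V$ means $U-V$ is positive semidefinite. The data of the spectratope are as follows: $P$ is a $p\times n$ matrix; $R_k[y]=\sum_{i=1}^n y_iR^{ki}$ with $R^{ki}\in\mathbf S^{d_k}$; $\mathcal T\subset\mathbf R^K_+$ is a monotonic set, i.e. a convex compact subset of $\mathbf R^K_+$ which contains a vector with all entries positive and such that $0\le t'\le t\in\mathcal T$ (entrywise) implies $t'\in\mathcal T$; and for every $y\neq0$ in $\mathbf R^n$ one has $R_k[y]\ne0$ for at least one $k\le K$. Notation: $[\mathcal R_k^*[\Lambda_k]]_{ij}=\frac12\mathrm{Tr}(\Lambda_k[R^{ki}R^{kj}+R^{kj}R^{ki}])$, $1\le i,j\le n$ (a linear map $\mathbf S^{d_k}\to\mathbf S^n$); $\lambda[\Lambda]=[\mathrm{Tr}(\Lambda_1);\dots;\mathrm{Tr}(\Lambda_K)]\in\mathbf R^K$; $\phi_{\mathcal T}(g)=\max_{t\in\mathcal T}g^Tt$. *)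

theory Defs
  imports "HOL-Analysis.Analysis" "Jordan_Normal_Form.Matrix"
begin

text \<open>
  Matrices and vectors whose sizes are natural numbers are those of Jordan_Normal_Form, with indices
  counted from 0. The number K of matrix inequalities is the cardinality of a finite index type,
  so that the set of admissible vectors t lives in the Euclidean space \<open>real ^ 'K\<close>.
  The sizes of the matrices indexed by k may differ.
\<close>

unbundle no inner_syntax
no_notation vec_nth (infixl "$" 90)

definition sym_mats :: "nat \<Rightarrow> real Matrix.mat set" where
  "sym_mats m = {A \<in> carrier_mat m m. transpose_mat A = A}"

definition mat_trace :: "real Matrix.mat \<Rightarrow> real" where
  "mat_trace A = (\<Sum>i<dim_row A. A $$ (i, i))"

definition quad :: "real Matrix.mat \<Rightarrow> real Matrix.vec \<Rightarrow> real" where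
  "quad A x = x \<bullet> (A *\<^sub>v x)"

definition psd :: "real Matrix.mat \<Rightarrow> bool" where
  "psd A \<longleftrightarrow> A \<in> sym_mats (dim_row A) \<and> (\<forall>v \<in> carrier_vec (dim_row A). 0 \<le> quad A v)"

text \<open>The sizes are compared explicitly because \<open>V - U\<close> takes its size from U alone.\<close>

definition loewner_le :: "real Matrix.mat \<Rightarrow> real Matrix.mat \<Rightarrow> bool" where
  "loewner_le U V \<longleftrightarrow> dim_row U = dim_row V \<and> dim_col U = dim_col V \<and> psd (V - U)"

definition monotonic_set :: "(real ^ 'K) set \<Rightarrow> bool" where
  "monotonic_set T \<longleftrightarrow>
     convex T \<and> compact T \<and>
     (\<forall>t \<in> T. \<forall>k. 0 \<le> vec_nth t k) \<and>
     (\<exists>t \<in> T. \<forall>k. 0 < vec_nth t k) \<and>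
     (\<forall>t \<in> T. \<forall>t'. (\<forall>k. 0 \<le> vec_nth t' k \<and> vec_nth t' k \<le> vec_nth t k) \<longrightarrow> t' \<in> T)"

definition phi :: "(real ^ 'K) set \<Rightarrow> real ^ 'K \<Rightarrow> real" where
  "phi T g = (SUP t \<in> T. inner g t)"

lemma phi_is_max:
  assumes "compact T" "T \<noteq> {}"
  shows "\<exists>t \<in> T. phi T g = inner g t \<and> (\<forall>s \<in> T. inner g s \<le> inner g t)"
proof -
  have "continuous_on T (\<lambda>t. inner g t)" by (intro continuous_intros)
  then obtain t where t: "t \<in> T" "\<forall>s \<in> T. inner g s \<le> inner g t"
    using continuous_attains_sup[OF assms] by blast
  have "phi T g = inner g t"
    unfolding phi_def using t by (intro cSup_eq_maximum) auto
  with t show ?thesis by blast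
qed

text \<open>\<open>R_map m n S y\<close> is the matrix $S[y]=\sum_{i<n} y_i S^i$ of size m.\<close>

definition R_map :: "nat \<Rightarrow> nat \<Rightarrow> (nat \<Rightarrow> real Matrix.mat) \<Rightarrow> real Matrix.vec \<Rightarrow> real Matrix.mat" where
  "R_map m n S y = Matrix.mat m m (\<lambda>(a, b). \<Sum>i<n. y $ i * S i $$ (a, b))"

definition R_adj :: "nat \<Rightarrow> (nat \<Rightarrow> real Matrix.mat) \<Rightarrow> real Matrix.mat \<Rightarrow> real Matrix.mat" where
  "R_adj n S L = Matrix.mat n n (\<lambda>(i, j). 1 / 2 * mat_trace (L * (S i * S j + S j * S i)))"

definition spectratope ::
  "nat \<Rightarrow> ('K::finite \<Rightarrow> nat) \<Rightarrow> real Matrix.mat \<Rightarrow> ('K \<Rightarrow> nat \<Rightarrow> real Matrix.mat) \<Rightarrow> (real ^ 'K) set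
    \<Rightarrow> real Matrix.vec set" where
  "spectratope n d P R T =
     {x. \<exists>y \<in> carrier_vec n. \<exists>t \<in> T. x = P *\<^sub>v y \<and>
        (\<forall>k. loewner_le (R_map (d k) n (R k) y * R_map (d k) n (R k) y)
                        (vec_nth t k \<cdot>\<^sub>m 1\<^sub>m (d k)))}"

definition Opt :: "real Matrix.mat \<Rightarrow> real Matrix.vec set \<Rightarrow> real" where
  "Opt C X = (SUP x \<in> X. quad C x)"

definition lambda_vec :: "('K::finite \<Rightarrow> real Matrix.mat) \<Rightarrow> real ^ 'K" where
  "lambda_vec L = (\<chi> k. mat_trace (L k))"

definition feasible ::
  "nat \<Rightarrow> ('K::finite \<Rightarrow> nat) \<Rightarrow> real Matrix.mat \<Rightarrow> real Matrix.mat \<Rightarrow> ('K \<Rightarrow> nat \<Rightarrow> real Matrix.mat)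
    \<Rightarrow> ('K \<Rightarrow> real Matrix.mat) set" where
  "feasible n d C P R =
     {L. (\<forall>k. L k \<in> sym_mats (d k) \<and> psd (L k)) \<and>
         loewner_le (transpose_mat P * C * P)
           (Matrix.mat n n (\<lambda>(i, j). \<Sum>k\<in>UNIV. R_adj n (R k) (L k) $$ (i, j)))}"

definition Opt_star ::
  "nat \<Rightarrow> ('K::finite \<Rightarrow> nat) \<Rightarrow> real Matrix.mat \<Rightarrow> real Matrix.mat \<Rightarrow> ('K \<Rightarrow> nat \<Rightarrow> real Matrix.mat)
    \<Rightarrow> (real ^ 'K) set \<Rightarrow> real" where
  "Opt_star n d C P R T = (INF L \<in> feasible n d C P R. phi T (lambda_vec L))"

end

theory Submission
  imports Defs
begin

text \<open>
  Weak duality is the estimate \<open>\<Sum>\<^sub>k Tr(\<Lambda>\<^sub>k R\<^sub>k[y]\<^sup>2) \<le> \<Sum>\<^sub>k t\<^sub>k Tr \<Lambda>\<^sub>k\<close>. For the converse, write B for the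
  matrix of the form \<open>x\<^sup>T C x\<close> in the variable y. If a number \<open>\<gamma> > 0\<close> bounds \<open>Tr(B Q)\<close> for all positive
  semidefinite Q that satisfy \<open>R\<^sub>k[Q] \<preceq> t\<^sub>k I\<close> with t in T, then the relaxation has a feasible point of
  value at most \<open>\<gamma>\<close>: project the compact set of all \<open>\<Sum>\<^sub>k R\<^sub>k*[\<Lambda>\<^sub>k] - B\<close> with \<open>\<phi>(\<lambda>[\<Lambda>]) \<le> \<gamma>\<close> onto the
  positive semidefinite cone; a nonzero residual is minus a matrix Q, and together with the polar of T
  it contradicts the bound. To bound \<open>Tr(B Q)\<close>, write Q as a sum of \<open>q\<^sub>j q\<^sub>j\<^sup>T\<close> with B-orthogonal \<open>q\<^sub>j\<close>
  and consider \<open>y = \<Sum>\<^sub>j \<plusminus>q\<^sub>j\<close>: then \<open>y\<^sup>T B y = Tr(B Q)\<close> for all signs, and by the noncommutative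
  Khintchine inequality some choice of signs satisfies \<open>R\<^sub>k[y]\<^sup>2 \<preceq> r t\<^sub>k I\<close> for all k, where
  \<open>r = 2 max(ln(2D), 1)\<close>.
\<close>

section \<open>Traces and powers of symmetric matrices\<close>

text \<open>Only compactness and finite sums are used: eigenvalues appear as maxima of quadratic
  forms, factorisations of Q as Cholesky factors, expectations as sums over all sign vectors. The
  constraint on R_k[y]^2 is quadratic in y but linear in y y^T; letting an arbitrary psd Q replace y
  y^T gives the relaxation dual to the problem in Lambda. The loss r is thus the price of returning
  from Q to a single y. The value of r has three sources. The even trace moments of a signed sum are
  at most the Gaussian ones, (2m-1)!! t_k^m d_k. After division by t_k^m they may be added over k,
  so that all K constraints together cost only the total size D. All orders m are used at once: if
  no choice of signs works, then cosh r <= D exp(r/2), and exp(r)/2 < cosh r gives r/2 < ln(2D). Opt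
  may be 0, whereas the duality argument scales by a positive level; so levels above r Opt are
  treated first, and compactness of the multiplier sets then reaches r Opt itself.\<close>

lemma scalar_prod_eq_sum: "y \<in> carrier_vec n \<Longrightarrow> x \<bullet> y = (\<Sum>i<n. x $ i * (y $ i :: real))"
  by (auto simp: scalar_prod_def atLeast0LessThan)

lemma mult_mat_vec_index:
  "A \<in> carrier_mat m n \<Longrightarrow> x \<in> carrier_vec n \<Longrightarrow> i < m \<Longrightarrow>
    (A *\<^sub>v x) $ i = (\<Sum>j<n. A $$ (i, j) * (x $ j :: real))"
  by (simp add: scalar_prod_eq_sum)

lemma mult_mat_index:
  "A \<in> carrier_mat m n \<Longrightarrow> B \<in> carrier_mat n l \<Longrightarrow> i < m \<Longrightarrow> j < l \<Longrightarrow>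
    (A * B) $$ (i, j) = (\<Sum>k<n. A $$ (i, k) * (B $$ (k, j) :: real))"
  by (simp add: scalar_prod_eq_sum[of _ n])

lemma quad_eq_sum:
  assumes "A \<in> carrier_mat n n" "x \<in> carrier_vec n"
  shows "quad A x = (\<Sum>i<n. \<Sum>j<n. x $ i * A $$ (i, j) * x $ j)"
proof -
  have "quad A x = (\<Sum>i<n. x $ i * (A *\<^sub>v x) $ i)"
    unfolding quad_def by (rule scalar_prod_eq_sum) (use assms in simp)
  also have "\<dots> = (\<Sum>i<n. \<Sum>j<n. x $ i * A $$ (i, j) * x $ j)"
    by (intro sum.cong) (use assms in \<open>auto simp del: index_mult_mat_vec simp: mult_mat_vec_index[OF assms] sum_distrib_left mult.assoc\<close>)
  finally show ?thesis .
qed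

lemma mat_trace_mult:
  assumes "A \<in> carrier_mat n m" "B \<in> carrier_mat m n"
  shows "mat_trace (A * B) = (\<Sum>i<n. \<Sum>j<m. A $$ (i, j) * B $$ (j, i))"
proof -
  have "dim_row (A * B) = n" using assms by simp
  then show ?thesis using mult_mat_index[OF assms] by (simp add: mat_trace_def del: index_mult_mat)
qed

lemma mat_trace_comm:
  assumes "A \<in> carrier_mat n m" "B \<in> carrier_mat m n"
  shows "mat_trace (A * B) = mat_trace (B * A)"
  unfolding mat_trace_mult[OF assms] mat_trace_mult[OF assms(2,1)]
  by (subst sum.swap) (simp add: mult.commute)

lemma mat_trace_minus:
  "A \<in> carrier_mat n n \<Longrightarrow> B \<in> carrier_mat n n \<Longrightarrow> mat_trace (A - B) = mat_trace A - mat_trace B"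
  by (simp add: mat_trace_def sum_subtractf)

lemma sym_matsD:
  assumes "A \<in> sym_mats n"
  shows "A \<in> carrier_mat n n" "transpose_mat A = A" "\<And>i j. i < n \<Longrightarrow> j < n \<Longrightarrow> A $$ (i, j) = A $$ (j, i)"
proof -
  show *: "A \<in> carrier_mat n n" "transpose_mat A = A" using assms by (auto simp: sym_mats_def)
  fix i j assume "i < n" "j < n"
  then show "A $$ (i, j) = A $$ (j, i)" using * by (metis carrier_matD index_transpose_mat(1))
qed

lemma sym_matsI:
  assumes "A \<in> carrier_mat n n" "\<And>i j. i < n \<Longrightarrow> j < n \<Longrightarrow> A $$ (i, j) = A $$ (j, i)"
  shows "A \<in> sym_mats n"
  using assms unfolding sym_mats_def by (auto intro!: eq_matI)

lemma pow_mat_add: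
  assumes "A \<in> carrier_mat n n"
  shows "A ^\<^sub>m (k + l) = A ^\<^sub>m k * A ^\<^sub>m l"
proof (induction l)
  case (Suc l)
  have "A ^\<^sub>m (k + Suc l) = A ^\<^sub>m k * A ^\<^sub>m l * A" using Suc by simp
  also have "\<dots> = A ^\<^sub>m k * (A ^\<^sub>m l * A)"
    by (rule assoc_mult_mat) (use assms in auto)
  finally show ?case by simp
qed (use assms in simp)

lemma pow_mat_Suc_left:
  assumes "A \<in> carrier_mat n n"
  shows "A ^\<^sub>m (Suc k) = A * A ^\<^sub>m k"
  using pow_mat_add[OF assms, of 1 k] assms by simp

lemma transpose_pow_mat:
  assumes "A \<in> sym_mats n"
  shows "transpose_mat (A ^\<^sub>m k) = A ^\<^sub>m k"
proof (induction k)
  case (Suc k)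
  note A = sym_matsD[OF assms]
  have "transpose_mat (A ^\<^sub>m Suc k) = transpose_mat A * transpose_mat (A ^\<^sub>m k)"
    using A(1) by (simp add: transpose_mult[of _ n n _ n])
  then show ?case using pow_mat_Suc_left[OF A(1)] A Suc by simp
qed simp

text \<open>The squared Frobenius norm. For symmetric \<open>X\<close> the even trace moment Tr
  X^(2m) is \<open>frobenius_sq (X ^\<^sub>m m)\<close>, a form in which nonnegativity is
  evident.\<close>

definition frobenius_sq :: "real mat \<Rightarrow> real" where
  "frobenius_sq A = (\<Sum>i<dim_row A. \<Sum>j<dim_col A. (A $$ (i, j))\<^sup>2)"

lemma frobenius_sq_nonneg: "0 \<le> frobenius_sq A"
  unfolding frobenius_sq_def by (intro sum_nonneg) auto

lemma frobenius_sq_transpose: "frobenius_sq (transpose_mat A) = frobenius_sq A"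
  unfolding frobenius_sq_def by (subst sum.swap) simp

lemma mat_trace_transpose_mult:
  assumes "A \<in> carrier_mat n m" "B \<in> carrier_mat n m"
  shows "mat_trace (transpose_mat A * B) = (\<Sum>i<n. \<Sum>j<m. A $$ (i, j) * B $$ (i, j))"
proof -
  have "mat_trace (transpose_mat A * B) = (\<Sum>j<m. \<Sum>i<n. A $$ (i, j) * B $$ (i, j))"
    using assms by (subst mat_trace_mult[of _ m n]) (auto intro!: sum.cong)
  then show ?thesis by (subst sum.swap) simp
qed

lemma mat_trace_transpose_self: "mat_trace (transpose_mat A * A) = frobenius_sq A"
  by (subst mat_trace_transpose_mult[of _ "dim_row A" "dim_col A"]) (auto simp: frobenius_sq_def power2_eq_square)

lemma frobenius_am_gm:
  assumes "A \<in> carrier_mat n m" "B \<in> carrier_mat n m"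
  shows "2 * mat_trace (transpose_mat A * B) \<le> frobenius_sq A + frobenius_sq B"
proof -
  have "2 * (x * y) \<le> x\<^sup>2 + y\<^sup>2" for x y :: real
    using sum_squares_bound[of x y] by simp
  then show ?thesis
    unfolding mat_trace_transpose_mult[OF assms] using assms
    by (auto simp: frobenius_sq_def sum_distrib_left sum.distrib[symmetric] intro!: sum_mono)
qed

lemma frobenius_sq_eq_sum_cols:
  assumes "A \<in> carrier_mat n m"
  shows "frobenius_sq A = (\<Sum>j<m. col A j \<bullet> col A j)"
  unfolding frobenius_sq_def using assms
  by (subst sum.swap) (auto simp: scalar_prod_eq_sum[of _ n] power2_eq_square intro!: sum.cong)

text \<open>Cauchy-Schwarz in each row: the Frobenius norm dominates the operator norm, so trace
  moments control all vectors at once.\<close>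

lemma frobenius_sq_mult_mat_vec_le:
  assumes "A \<in> carrier_mat n m" "v \<in> carrier_vec m"
  shows "(A *\<^sub>v v) \<bullet> (A *\<^sub>v v) \<le> frobenius_sq A * (v \<bullet> v)"
proof -
  have "(A *\<^sub>v v) \<bullet> (A *\<^sub>v v) = (\<Sum>i<n. (\<Sum>j<m. A $$ (i, j) * v $ j)\<^sup>2)"
    using assms by (simp del: index_mult_mat_vec add: scalar_prod_eq_sum[of _ n] power2_eq_square mult_mat_vec_index[OF assms])
  also have "\<dots> \<le> (\<Sum>i<n. (\<Sum>j<m. (A $$ (i, j))\<^sup>2) * (\<Sum>j<m. (v $ j)\<^sup>2))"
    by (intro sum_mono Cauchy_Schwarz_ineq_sum)
  also have "\<dots> = frobenius_sq A * (v \<bullet> v)"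
    using assms by (simp add: frobenius_sq_def sum_distrib_right scalar_prod_eq_sum[of _ m] power2_eq_square)
  finally show ?thesis .
qed

text \<open>The symmetrisation \<open>g q + g (2 * m - q)\<close> attains its maximum at \<open>q = 0\<close>: at a maximiser \<open>b \<le> m\<close> the
  hypothesis compares its value with those at 0 and at \<open>2 * b\<close>.\<close>

lemma sum_midpoint_convex_le:
  fixes g :: "nat \<Rightarrow> real"
  assumes g: "\<And>a b. a \<le> m \<Longrightarrow> b \<le> m \<Longrightarrow> 2 * g (a + b) \<le> g (2 * a) + g (2 * b)"
  shows "(\<Sum>q\<le>2 * m. g q) \<le> (2 * real m + 1) / 2 * (g 0 + g (2 * m))"
proof -
  define h where "h q = g q + g (2 * m - q)" for q
  define M where "M = Max (h ` {..2 * m})"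
  have hM: "h q \<le> M" if "q \<le> 2 * m" for q
    unfolding M_def using that by (intro Max_ge) auto
  have "M \<in> h ` {..2 * m}" unfolding M_def by (intro Max_in) auto
  then obtain q where q: "q \<le> 2 * m" "h q = M" by auto
  \<comment> \<open>\<open>h\<close> is invariant under q -> 2m - q, so a maximiser may be taken in
    the lower half, where the doubled index stays in range.\<close>
  have "\<exists>b \<le> m. h b = M"
  proof (cases "q \<le> m")
    case False
    then have "h (2 * m - q) = h q" using q by (simp add: h_def add.commute)
    then show ?thesis using q False by (intro exI[of _ "2 * m - q"]) auto
  qed (use q in auto)
  then obtain b where b: "b \<le> m" "h b = M" by blast
  \<comment> \<open>The reflected index is a sum of two indices at most \<open>m\<close>, so the
    hypothesis applies to both halves of \<open>h b\<close>.\<close>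
  have "2 * m - b = m + (m - b)" "2 * m - 2 * b = 2 * (m - b)" using b by auto
  then have "2 * h b \<le> h 0 + h (2 * b)"
    using g[of 0 b] g[of m "m - b"] b unfolding h_def by simp
  with hM[of "2 * b"] b have M: "M \<le> h 0" by simp
  have "2 * (\<Sum>q\<le>2 * m. g q) = (\<Sum>q\<le>2 * m. h q)"
    unfolding h_def sum.distrib using sum.nat_diff_reindex[of g "Suc (2 * m)"]
    by (simp add: lessThan_Suc_atMost)
  also have "\<dots> \<le> (\<Sum>q\<le>2 * m. h 0)" using hM M by (intro sum_mono) (meson atMost_iff order_trans)
  finally show ?thesis by (simp add: h_def field_simps)
qed

text \<open>The summand with index \<open>a + b\<close> is the Frobenius inner product of \<open>M a\<close> and \<open>M b\<close>, where
  \<open>M a = U ^ a * A * W ^ (m - a)\<close>; so it satisfies the midpoint inequality.\<close>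

lemma trace_pow_mixed_le:
  assumes A: "A \<in> sym_mats d" and U: "U \<in> sym_mats d" and W: "W \<in> sym_mats d"
  shows "(\<Sum>q\<le>2 * m. mat_trace (A * U ^\<^sub>m q * (A * W ^\<^sub>m (2 * m - q))))
    \<le> (2 * real m + 1) / 2 * (frobenius_sq (A * W ^\<^sub>m m) + frobenius_sq (A * U ^\<^sub>m m))"
proof -
  note [simp] = sym_matsD(1)[OF A] sym_matsD(1)[OF U] sym_matsD(1)[OF W]
  note [simp] = carrier_matD[OF sym_matsD(1)[OF U]] carrier_matD[OF sym_matsD(1)[OF W]]
  note [simp] = mult_carrier_mat[of _ d d _ d] assoc_mult_mat[of _ d d _ d _ d]
  define g where "g q = mat_trace (A * U ^\<^sub>m q * (A * W ^\<^sub>m (2 * m - q)))" for q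
  define M where "M a = U ^\<^sub>m a * (A * W ^\<^sub>m (m - a))" for a
  have Mc: "M a \<in> carrier_mat d d" for a by (simp add: M_def)
  have Mg: "mat_trace (transpose_mat (M a) * M b) = g (a + b)" if "a \<le> m" "b \<le> m" for a b
  proof -
    have "transpose_mat (M a) = W ^\<^sub>m (m - a) * (A * U ^\<^sub>m a)"
      unfolding M_def using sym_matsD(2)[OF A] transpose_pow_mat[OF U] transpose_pow_mat[OF W]
      by (simp add: transpose_mult[of _ d d _ d])
    then have "mat_trace (transpose_mat (M a) * M b)
        = mat_trace (W ^\<^sub>m (m - a) * (A * U ^\<^sub>m a * M b))"
      by (simp add: M_def)
    \<comment> \<open>Cyclicity of the trace brings the two powers of \<open>W\<close>
      together.\<close>
    also have "\<dots> = mat_trace (A * U ^\<^sub>m a * M b * W ^\<^sub>m (m - a))"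
      using Mc by (intro mat_trace_comm[of _ d d]) simp_all
    also have "A * U ^\<^sub>m a * M b * W ^\<^sub>m (m - a)
        = A * (U ^\<^sub>m a * U ^\<^sub>m b) * (A * (W ^\<^sub>m (m - b) * W ^\<^sub>m (m - a)))"
      by (simp add: M_def)
    also have "\<dots> = A * U ^\<^sub>m (a + b) * (A * W ^\<^sub>m (2 * m - (a + b)))"
    proof -
      have "2 * m - (a + b) = (m - b) + (m - a)" using that by simp
      then show ?thesis by (simp only: pow_mat_add[OF sym_matsD(1)[OF U]] pow_mat_add[OF sym_matsD(1)[OF W]])
    qed
    finally show ?thesis by (simp add: g_def)
  qed
  have fM: "frobenius_sq (M a) = g (2 * a)" if "a \<le> m" for a
    using Mg[OF that that] by (simp add: mat_trace_transpose_self mult_2)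
  have "2 * g (a + b) \<le> g (2 * a) + g (2 * b)" if "a \<le> m" "b \<le> m" for a b
    using frobenius_am_gm[OF Mc Mc, of a b] by (simp add: Mg fM that)
  then have "(\<Sum>q\<le>2 * m. g q) \<le> (2 * real m + 1) / 2 * (g 0 + g (2 * m))"
    by (rule sum_midpoint_convex_le)
  moreover have "g 0 = frobenius_sq (A * W ^\<^sub>m m)"
    using fM[of 0] by (simp add: M_def left_mult_one_mat[of _ d d])
  moreover have "g (2 * m) = frobenius_sq (A * U ^\<^sub>m m)"
  proof -
    have "M m = transpose_mat (A * U ^\<^sub>m m)"
      using sym_matsD(2)[OF A] transpose_pow_mat[OF U]
      by (simp add: M_def transpose_mult[of _ d d _ d] right_mult_one_mat[of _ d d])
    then show ?thesis using fM[of m] by (simp add: frobenius_sq_transpose)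
  qed
  ultimately show ?thesis unfolding g_def by simp
qed

section \<open>The noncommutative Khintchine inequality\<close>

lemma R_map_carrier [simp]: "R_map m n S y \<in> carrier_mat m m"
  by (simp add: R_map_def)

lemma R_map_dim [simp]: "dim_row (R_map m n S y) = m" "dim_col (R_map m n S y) = m"
  by (simp_all add: R_map_def)

lemma R_map_index [simp]:
  "a < m \<Longrightarrow> b < m \<Longrightarrow> R_map m n S y $$ (a, b) = (\<Sum>i<n. y $ i * S i $$ (a, b))"
  by (simp add: R_map_def)

lemma R_map_sym: "(\<And>i. i < n \<Longrightarrow> S i \<in> sym_mats m) \<Longrightarrow> R_map m n S y \<in> sym_mats m"
  by (intro sym_matsI) (auto intro!: sum.cong intro: arg_cong[of _ _ "(*) _"] sym_matsD(3))

lemma mat_trace_R_map_mult: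
  assumes "\<And>i. i < n \<Longrightarrow> S i \<in> carrier_mat m m" "M \<in> carrier_mat m m"
  shows "mat_trace (R_map m n S y * M) = (\<Sum>i<n. y $ i * mat_trace (S i * M))"
proof -
  have "mat_trace (R_map m n S y * M) = (\<Sum>a<m. \<Sum>b<m. \<Sum>i<n. y $ i * (S i $$ (a, b) * M $$ (b, a)))"
    using assms by (simp add: mat_trace_mult[of _ m m] sum_distrib_right mult.assoc)
  also have "\<dots> = (\<Sum>a<m. \<Sum>i<n. \<Sum>b<m. y $ i * (S i $$ (a, b) * M $$ (b, a)))"
    by (intro sum.cong refl sum.swap)
  also have "\<dots> = (\<Sum>i<n. \<Sum>a<m. \<Sum>b<m. y $ i * (S i $$ (a, b) * M $$ (b, a)))"
    by (rule sum.swap)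
  also have "\<dots> = (\<Sum>i<n. y $ i * mat_trace (S i * M))"
    using assms by (intro sum.cong refl) (simp add: mat_trace_mult[of _ m m] sum_distrib_left)
  finally show ?thesis .
qed

lemma mat_trace_smult: "A \<in> carrier_mat n n \<Longrightarrow> mat_trace (c \<cdot>\<^sub>m A) = c * mat_trace A"
  by (simp add: mat_trace_def sum_distrib_left)

text \<open>Noncommutative telescoping: the intermediate products
  \<open>A * U ^\<^sub>m q * W ^\<^sub>m (n - q)\<close> exchange one factor \<open>W\<close> for
  \<open>U\<close> at a time.\<close>

lemma mat_trace_pow_diff:
  assumes A: "A \<in> carrier_mat d d" and U: "U \<in> carrier_mat d d" and W: "W \<in> carrier_mat d d"
  shows "mat_trace (A * U ^\<^sub>m n) - mat_trace (A * W ^\<^sub>m n)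
    = (\<Sum>q<n. mat_trace (A * U ^\<^sub>m q * ((U - W) * W ^\<^sub>m (n - Suc q))))"
proof -
  note [simp] = A U W carrier_matD[OF U] carrier_matD[OF W] mult_carrier_mat[of _ d d _ d] assoc_mult_mat[of _ d d _ d _ d]
  define F where "F q = mat_trace (A * U ^\<^sub>m q * W ^\<^sub>m (n - q))" for q
  have "F (Suc q) - F q = mat_trace (A * U ^\<^sub>m q * ((U - W) * W ^\<^sub>m (n - Suc q)))" if "q < n" for q
  proof -
    let ?V = "W ^\<^sub>m (n - Suc q)"
    have "n - q = Suc (n - Suc q)" using that by simp
    then have "W ^\<^sub>m (n - q) = W * ?V" using pow_mat_Suc_left[OF W] by metis
    then have "F (Suc q) - F q = mat_trace (A * U ^\<^sub>m q * (U * ?V) - A * U ^\<^sub>m q * (W * ?V))"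
      by (simp add: F_def mat_trace_minus[of _ d])
    also have "A * U ^\<^sub>m q * (U * ?V) - A * U ^\<^sub>m q * (W * ?V) = A * U ^\<^sub>m q * ((U - W) * ?V)"
      by (simp add: minus_mult_distrib_mat[of _ d d _ _ d] mult_minus_distrib_mat[of _ d d _ d] minus_carrier_mat
          del: assoc_mult_mat)
    finally show ?thesis .
  qed
  then have "(\<Sum>q<n. mat_trace (A * U ^\<^sub>m q * ((U - W) * W ^\<^sub>m (n - Suc q)))) = F n - F 0"
    by (simp add: sum_lessThan_telescope[symmetric])
  then show ?thesis by (simp add: F_def left_mult_one_mat[of _ d d] right_mult_one_mat[of _ d d])
qed

text \<open>Extensional functions, so that the set is finite; sums over it are unnormalised
  expectations over independent random signs.\<close>

definition signs :: "nat \<Rightarrow> (nat \<Rightarrow> real) set" where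
  "signs N = (\<Pi>\<^sub>E i\<in>{..<N}. {-1, 1})"

lemma finite_signs: "finite (signs N)" and signs_nonempty: "signs N \<noteq> {}"
  by (auto simp: signs_def intro!: finite_PiE simp: PiE_eq_empty_iff)

lemma sum_signs_flip:
  assumes "i < N"
  shows "(\<Sum>e\<in>signs N. F (e(i := - e i))) = (\<Sum>e\<in>signs N. F e)"
  by (rule sum.reindex_bij_witness[where i = "\<lambda>e. e(i := - e i)" and j = "\<lambda>e. e(i := - e i)"])
     (use assms in \<open>auto simp: signs_def PiE_iff extensional_def\<close>)

text \<open>Pairing a choice of signs with the one that differs in the i-th sign turns the i-th summand of
  \<open>Tr(X ^ (2 * m + 2)) = \<Sum>\<^sub>i e\<^sub>i Tr(S\<^sub>i X ^ (2 * m + 1))\<close> into a difference of powers, which telescopes.\<close>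

lemma khintchine_step:
  assumes S: "\<And>i. i < N \<Longrightarrow> S i \<in> sym_mats d"
    and t: "\<And>v. v \<in> carrier_vec d \<Longrightarrow> (\<Sum>i<N. (S i *\<^sub>v v) \<bullet> (S i *\<^sub>v v)) \<le> t * (v \<bullet> v)"
  defines "X \<equiv> \<lambda>e. R_map d N S (Matrix.vec N e)"
  shows "(\<Sum>e\<in>signs N. frobenius_sq (X e ^\<^sub>m Suc m)) \<le> (2 * real m + 1) * t * (\<Sum>e\<in>signs N. frobenius_sq (X e ^\<^sub>m m))"
proof -
  have Xs: "X e \<in> sym_mats d" for e unfolding X_def by (rule R_map_sym[OF S])
  note Xc = sym_matsD(1)[OF Xs] and Sc = sym_matsD(1)[OF S]
  note [simp] = Xc mult_carrier_mat[of _ d d _ d]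
  define f where "f i e = mat_trace (S i * X e ^\<^sub>m (2 * m + 1))" for i e
  have 1: "frobenius_sq (X e ^\<^sub>m Suc m) = (\<Sum>i<N. e i * f i e)" for e
  proof -
    have "frobenius_sq (X e ^\<^sub>m Suc m) = mat_trace (X e ^\<^sub>m Suc m * X e ^\<^sub>m Suc m)"
      by (metis mat_trace_transpose_self transpose_pow_mat[OF Xs])
    also have "X e ^\<^sub>m Suc m * X e ^\<^sub>m Suc m = X e ^\<^sub>m Suc (2 * m + 1)"
      by (subst pow_mat_add[OF Xc, symmetric]) (simp add: mult_2)
    also have "\<dots> = X e * X e ^\<^sub>m (2 * m + 1)" by (rule pow_mat_Suc_left[OF Xc])
    also have "mat_trace \<dots> = (\<Sum>i<N. e i * f i e)"
      unfolding f_def by (subst (1) X_def, subst mat_trace_R_map_mult) (auto simp: Sc)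
    finally show ?thesis .
  qed
  have 2: "(\<Sum>e\<in>signs N. e i * f i e) \<le> (2 * real m + 1) * (\<Sum>e\<in>signs N. frobenius_sq (S i * X e ^\<^sub>m m))" if i: "i < N" for i
  proof -
    define fl where "fl e = e(i := - e i)" for e :: "nat \<Rightarrow> real"
    have le: "e i * (f i e - f i (fl e)) \<le> (2 * real m + 1) * (frobenius_sq (S i * X (fl e) ^\<^sub>m m) + frobenius_sq (S i * X e ^\<^sub>m m))"
      if e: "e \<in> signs N" for e
    proof -
      have ei: "e i * e i = 1" using e i by (force simp: signs_def PiE_iff)
      have D: "X e - X (fl e) = (2 * e i) \<cdot>\<^sub>m S i"
      proof (rule eq_matI)
        fix a b assume ab: "a < dim_row ((2 * e i) \<cdot>\<^sub>m S i)" "b < dim_col ((2 * e i) \<cdot>\<^sub>m S i)"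
        then have ab': "a < d" "b < d" using Sc[OF i] by auto
        have "(X e - X (fl e)) $$ (a, b) = (\<Sum>j<N. (e j - fl e j) * S j $$ (a, b))"
          using ab' by (simp add: X_def left_diff_distrib sum_subtractf)
        also have "\<dots> = (\<Sum>j<N. if j = i then 2 * e i * S i $$ (a, b) else 0)"
          by (intro sum.cong) (auto simp: fl_def)
        also have "\<dots> = ((2 * e i) \<cdot>\<^sub>m S i) $$ (a, b)" using i ab by simp
        finally show "(X e - X (fl e)) $$ (a, b) = ((2 * e i) \<cdot>\<^sub>m S i) $$ (a, b)" .
      qed (use Sc[OF i] in \<open>auto simp: X_def\<close>)
      have "f i e - f i (fl e)
        = (\<Sum>q<2 * m + 1. mat_trace (S i * X e ^\<^sub>m q * ((X e - X (fl e)) * X (fl e) ^\<^sub>m (2 * m + 1 - Suc q))))"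
        unfolding f_def by (rule mat_trace_pow_diff[OF Sc[OF i] Xc Xc])
      also have "\<dots> = (\<Sum>q<2 * m + 1. 2 * e i * mat_trace (S i * X e ^\<^sub>m q * (S i * X (fl e) ^\<^sub>m (2 * m - q))))"
        unfolding D using Sc[OF i]
        by (intro sum.cong refl) (simp add: mult_smult_assoc_mat[of _ d d _ d] mult_smult_distrib[of _ d d _ d] mat_trace_smult[of _ d])
      also have "\<dots> = 2 * e i * (\<Sum>q\<le>2 * m. mat_trace (S i * X e ^\<^sub>m q * (S i * X (fl e) ^\<^sub>m (2 * m - q))))"
        by (simp add: sum_distrib_left lessThan_Suc_atMost)
      finally have "e i * (f i e - f i (fl e))
        = 2 * (e i * e i) * (\<Sum>q\<le>2 * m. mat_trace (S i * X e ^\<^sub>m q * (S i * X (fl e) ^\<^sub>m (2 * m - q))))"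
        by simp
      \<comment> \<open>The sign \<open>e i\<close> occurs twice, once as the weight and once in
        \<open>X e - X (fl e)\<close>, and cancels; the estimate is the same for both signs.\<close>
      also have "\<dots> \<le> 2 * ((2 * real m + 1) / 2 * (frobenius_sq (S i * X (fl e) ^\<^sub>m m) + frobenius_sq (S i * X e ^\<^sub>m m)))"
        using trace_pow_mixed_le[OF S[OF i] Xs[of e] Xs[of "fl e"], of m] ei by simp
      finally show ?thesis by simp
    qed
    have "(\<Sum>e\<in>signs N. e i * f i e) = (\<Sum>e\<in>signs N. fl e i * f i (fl e))"
      unfolding fl_def by (rule sum_signs_flip[OF i, symmetric])
    also have "\<dots> = (\<Sum>e\<in>signs N. - e i * f i (fl e))" by (simp add: fl_def)
    finally have "2 * (\<Sum>e\<in>signs N. e i * f i e) = (\<Sum>e\<in>signs N. e i * (f i e - f i (fl e)))"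
      by (simp add: sum_subtractf right_diff_distrib sum_negf)
    also have "\<dots> \<le> (\<Sum>e\<in>signs N. (2 * real m + 1) * (frobenius_sq (S i * X (fl e) ^\<^sub>m m) + frobenius_sq (S i * X e ^\<^sub>m m)))"
      by (intro sum_mono le)
    also have "\<dots> = (2 * real m + 1) * ((\<Sum>e\<in>signs N. frobenius_sq (S i * X (fl e) ^\<^sub>m m)) + (\<Sum>e\<in>signs N. frobenius_sq (S i * X e ^\<^sub>m m)))"
      by (simp add: sum_distrib_left sum.distrib distrib_left)
    \<comment> \<open>The flip permutes the sign vectors, so both Frobenius sums coincide and the
      factor 2 from the pairing cancels.\<close>
    also have "(\<Sum>e\<in>signs N. frobenius_sq (S i * X (fl e) ^\<^sub>m m)) = (\<Sum>e\<in>signs N. frobenius_sq (S i * X e ^\<^sub>m m))"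
      unfolding fl_def by (rule sum_signs_flip[OF i])
    finally show ?thesis by simp
  qed
  \<comment> \<open>The hypothesis on \<open>t\<close> bounds the sum of the squares of the
    \<open>S i\<close> by \<open>t\<close> times the identity; it is applied to each column of
    \<open>M\<close>.\<close>
  have 3: "(\<Sum>i<N. frobenius_sq (S i * M)) \<le> t * frobenius_sq M" if M: "M \<in> carrier_mat d d" for M
  proof -
    have "(\<Sum>i<N. frobenius_sq (S i * M)) = (\<Sum>i<N. \<Sum>j<d. (S i *\<^sub>v col M j) \<bullet> (S i *\<^sub>v col M j))"
      using M Sc by (intro sum.cong refl) (simp add: frobenius_sq_eq_sum_cols[of _ d d] col_mult2[of _ d d _ d])
    also have "\<dots> = (\<Sum>j<d. \<Sum>i<N. (S i *\<^sub>v col M j) \<bullet> (S i *\<^sub>v col M j))"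
      by (rule sum.swap)
    also have "\<dots> \<le> (\<Sum>j<d. t * (col M j \<bullet> col M j))"
      using M by (intro sum_mono t) auto
    also have "\<dots> = t * frobenius_sq M" using M by (simp add: frobenius_sq_eq_sum_cols[of _ d d] sum_distrib_left)
    finally show ?thesis .
  qed
  have "(\<Sum>e\<in>signs N. frobenius_sq (X e ^\<^sub>m Suc m)) = (\<Sum>i<N. \<Sum>e\<in>signs N. e i * f i e)"
    unfolding 1 by (rule sum.swap)
  also have "\<dots> \<le> (\<Sum>i<N. (2 * real m + 1) * (\<Sum>e\<in>signs N. frobenius_sq (S i * X e ^\<^sub>m m)))"
    by (intro sum_mono 2) auto
  also have "\<dots> = (2 * real m + 1) * (\<Sum>e\<in>signs N. \<Sum>i<N. frobenius_sq (S i * X e ^\<^sub>m m))"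
    by (subst sum.swap) (simp add: sum_distrib_left)
  also have "\<dots> \<le> (2 * real m + 1) * (\<Sum>e\<in>signs N. t * frobenius_sq (X e ^\<^sub>m m))"
    by (intro mult_left_mono sum_mono 3) auto
  finally show ?thesis by (simp add: sum_distrib_left mult.assoc)
qed

text \<open>The step is iterated from \<open>m = 0\<close>, where the trace of the identity
  contributes \<open>d\<close>. The product is the double factorial (2m-1)!!, the moment of order 2m
  of a standard Gaussian.\<close>

lemma khintchine_moments:
  assumes S: "\<And>i. i < N \<Longrightarrow> S i \<in> sym_mats d"
    and t: "\<And>v. v \<in> carrier_vec d \<Longrightarrow> (\<Sum>i<N. (S i *\<^sub>v v) \<bullet> (S i *\<^sub>v v)) \<le> t * (v \<bullet> v)"
    and "0 \<le> t"
  shows "(\<Sum>e\<in>signs N. frobenius_sq (R_map d N S (Matrix.vec N e) ^\<^sub>m m))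
    \<le> (\<Prod>i<m. 2 * real i + 1) * t ^ m * d * card (signs N)"
proof (induction m)
  case 0
  have "frobenius_sq (1\<^sub>m d) = d"
    unfolding frobenius_sq_def by (simp add: if_distrib[of "\<lambda>x. x\<^sup>2"] cong: if_cong)
  then show ?case by (simp add: carrier_matD[OF R_map_carrier])
next
  case (Suc m)
  have "(\<Sum>e\<in>signs N. frobenius_sq (R_map d N S (Matrix.vec N e) ^\<^sub>m Suc m))
      \<le> (2 * real m + 1) * t * (\<Sum>e\<in>signs N. frobenius_sq (R_map d N S (Matrix.vec N e) ^\<^sub>m m))"
    by (rule khintchine_step[OF S t])
  also have "\<dots> \<le> (2 * real m + 1) * t * ((\<Prod>i<m. 2 * real i + 1) * t ^ m * d * card (signs N))"
    using Suc \<open>0 \<le> t\<close> by (intro mult_left_mono) auto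
  finally show ?case by (simp add: algebra_simps)
qed

section \<open>From moment bounds to a good choice of signs\<close>

lemma Cauchy_Schwarz_scalar_prod:
  assumes "x \<in> carrier_vec n" "y \<in> carrier_vec n"
  shows "(x \<bullet> y)\<^sup>2 \<le> (x \<bullet> x) * (y \<bullet> (y :: real Matrix.vec))"
  using Cauchy_Schwarz_ineq_sum[of "\<lambda>i. x $ i" "\<lambda>i. y $ i" "{..<n}"] assms
  by (simp add: scalar_prod_eq_sum[of _ n] power2_eq_square)

lemma scalar_prod_self_nonneg: "0 \<le> x \<bullet> (x :: real Matrix.vec)"
  by (auto simp: scalar_prod_def intro: sum_nonneg)

lemma sym_mat_scalar_prod:
  assumes "A \<in> sym_mats n" "x \<in> carrier_vec n" "y \<in> carrier_vec n"
  shows "(A *\<^sub>v x) \<bullet> y = x \<bullet> (A *\<^sub>v y)"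
  using transpose_vec_mult_scalar[of A n n y x] sym_matsD[OF assms(1)] assms by simp

text \<open>By Cauchy-Schwarz and symmetry of \<open>X\<close>, the squared norms of
  \<open>X ^\<^sub>m j *\<^sub>v v\<close> are log-convex in \<open>j\<close>, so their successive
  ratios never drop below the first. A vector that violates a norm bound thus does the work of an
  eigenvector.\<close>

lemma power_mat_vec_growth:
  assumes X: "X \<in> sym_mats d" and v: "v \<in> carrier_vec d" and "0 \<le> c"
    and c: "c * (v \<bullet> v) \<le> (X *\<^sub>v v) \<bullet> (X *\<^sub>v v)"
  shows "c ^ m * (v \<bullet> v) \<le> (X ^\<^sub>m m *\<^sub>v v) \<bullet> (X ^\<^sub>m m *\<^sub>v v)"
proof -
  note Xc = sym_matsD(1)[OF X]
  define w where "w j = X ^\<^sub>m j *\<^sub>v v" for j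
  define h where "h j = w j \<bullet> w j" for j
  have wc: "w j \<in> carrier_vec d" for j using Xc v by (simp add: w_def mult_mat_vec_carrier[of _ d d])
  have wS: "w (Suc j) = X *\<^sub>v w j" for j
    unfolding w_def pow_mat_Suc_left[OF Xc] using Xc v by (simp add: assoc_mult_mat_vec[of _ d d _ d])
  have h0: "0 \<le> h j" for j by (simp add: h_def scalar_prod_self_nonneg)
  have w0: "w 0 = v" using Xc v by (simp add: w_def carrier_matD[OF Xc])
  have cs: "(h (Suc j))\<^sup>2 \<le> h j * h (Suc (Suc j))" for j
  proof -
    have "h (Suc j) = w j \<bullet> w (Suc (Suc j))"
      unfolding h_def using sym_mat_scalar_prod[OF X wc[of j] wc[of "Suc j"]] by (simp add: wS)
    then show ?thesis using Cauchy_Schwarz_scalar_prod[OF wc wc, of j "Suc (Suc j)"] by (simp add: h_def)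
  qed
  have step: "c * h j \<le> h (Suc j)" for j
  proof (induction j)
    case 0
    then show ?case using c unfolding h_def wS w0 .
  next
    case (Suc j)
    show ?case
    proof (cases "h (Suc j) = 0")
      case False
      then have pos: "0 < h (Suc j)" using h0[of "Suc j"] by simp
      have "c * (h (Suc j))\<^sup>2 \<le> (c * h j) * h (Suc (Suc j))"
        using mult_left_mono[OF cs \<open>0 \<le> c\<close>] by (simp add: mult.assoc)
      also have "\<dots> \<le> h (Suc j) * h (Suc (Suc j))" by (intro mult_right_mono Suc h0)
      finally show ?thesis using pos by (simp add: power2_eq_square)
    qed (use h0 in simp)
  qed
  have "c ^ m * h 0 \<le> h m"
  proof (induction m)
    case (Suc m)
    have "c ^ Suc m * h 0 \<le> c * h m" using mult_left_mono[OF Suc \<open>0 \<le> c\<close>] by (simp add: mult.assoc)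
    with step[of m] show ?case by simp
  qed simp
  then show ?thesis by (simp add: h_def w0) (simp add: w_def)
qed

lemma fact_double: "fact (2 * m) = (2 ^ m * fact m * (\<Prod>i<m. 2 * real i + 1) :: real)"
proof (induction m)
  case (Suc m)
  let ?p = "\<Prod>i<m. 2 * real i + 1"
  have "2 * Suc m = Suc (Suc (2 * m))" by simp
  then have "fact (2 * Suc m) = of_nat (Suc (Suc (2 * m))) * (of_nat (Suc (2 * m)) * (fact (2 * m) :: real))"
    by (simp only: fact_Suc)
  also have "\<dots> = (2 * (1 + real m)) * ((2 * real m + 1) * (2 ^ m * fact m * ?p))"
    by (simp add: Suc)
  also have "\<dots> = 2 ^ Suc m * fact (Suc m) * (?p * (2 * real m + 1))" by simp
  finally show ?case by (simp only: prod.lessThan_Suc)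
qed simp

text \<open>Summing the moment bounds against \<open>r ^ m / (2 * m)!\<close> turns them into
  \<open>cosh r \<le> D * exp (r / 2)\<close>, the optimal choice in the Laplace transform argument.\<close>

lemma double_fact_moments_bound:
  assumes "0 < r" and le: "\<And>m. r ^ m \<le> (\<Prod>i<m. 2 * real i + 1) * D"
  shows "exp (r / 2) < 2 * D"
proof -
  \<comment> \<open>The series of \<open>cosh\<close> has zero terms at odd indices; reindexing by
    the even ones removes them.\<close>
  have "inj (\<lambda>m::nat. 2 * m)" by (simp add: inj_on_def)
  then have "(\<lambda>m. (if even (2 * m) then r ^ (2 * m) /\<^sub>R fact (2 * m) else 0)) sums cosh r"
    using cosh_converges[of r]
    by (subst sums_mono_reindex[of "\<lambda>m::nat. 2 * m" "\<lambda>n. if even n then r ^ n /\<^sub>R fact n else 0", unfolded o_def])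
       (auto simp: strict_mono_def elim!: evenE)
  then have 1: "(\<lambda>m. r ^ (2 * m) / fact (2 * m)) sums cosh r" by (simp add: field_simps)
  have "(\<lambda>m. (r / 2) ^ m /\<^sub>R fact m) sums exp (r / 2)" by (rule exp_converges)
  then have 2: "(\<lambda>m. D * ((r / 2) ^ m /\<^sub>R fact m)) sums (D * exp (r / 2))" by (rule sums_mult)
  have "r ^ (2 * m) / fact (2 * m) \<le> D * ((r / 2) ^ m /\<^sub>R fact m)" for m
  proof -
    let ?p = "\<Prod>i<m. 2 * real i + 1"
    have p: "0 < ?p" by (intro prod_pos) auto
    have "r ^ (2 * m) / fact (2 * m) = r ^ m * (r ^ m / (2 ^ m * fact m * ?p))"
      by (simp add: fact_double power_even_eq power2_eq_square)
    also have "\<dots> \<le> (?p * D) * (r ^ m / (2 ^ m * fact m * ?p))"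
      using p \<open>0 < r\<close> by (intro mult_right_mono le) auto
    also have "\<dots> = D * ((r / 2) ^ m /\<^sub>R fact m)"
      using p by (simp add: field_simps power_divide)
    finally show ?thesis .
  qed
  then have "cosh r \<le> D * exp (r / 2)" using 1 2 by (rule sums_le)
  \<comment> \<open>The omitted term \<open>exp (- r) / 2\<close> is positive; this strictness
    excludes the borderline r/2 = ln(2D).\<close>
  moreover have "exp r / 2 < cosh r" by (simp add: cosh_def)
  moreover have "exp r = exp (r / 2) * exp (r / 2)" by (simp add: exp_add[symmetric])
  ultimately have "exp (r / 2) * exp (r / 2) < 2 * (D * exp (r / 2))" by linarith
  then show ?thesis by simp
qed

text \<open>If every sign vector failed, growth along a violating vector would give (r t_k)^m <= Tr
  X_k^(2m) for some \<open>k\<close> and every \<open>m\<close>. Dividing by t_k^m and summing over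
  \<open>k\<close> makes the estimate independent of which \<open>k\<close> fails; averaging over
  the signs then yields the hypothesis of \<open>double_fact_moments_bound\<close>.\<close>

theorem random_signs_rounding:
  fixes A :: "'K::finite \<Rightarrow> nat \<Rightarrow> real mat" and t :: "'K \<Rightarrow> real"
  assumes A: "\<And>k j. j < N \<Longrightarrow> A k j \<in> sym_mats (d k)"
    and t0: "\<And>k. 0 \<le> t k"
    and t: "\<And>k v. v \<in> carrier_vec (d k) \<Longrightarrow> (\<Sum>j<N. (A k j *\<^sub>v v) \<bullet> (A k j *\<^sub>v v)) \<le> t k * (v \<bullet> v)"
  defines "X \<equiv> \<lambda>e k. R_map (d k) N (A k) (Matrix.vec N e)"
  defines "r \<equiv> 2 * max (ln (2 * real (\<Sum>k\<in>UNIV. d k))) 1"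
  shows "\<exists>e\<in>signs N. \<forall>k. \<forall>v\<in>carrier_vec (d k). (X e k *\<^sub>v v) \<bullet> (X e k *\<^sub>v v) \<le> r * t k * (v \<bullet> v)"
proof (rule ccontr)
  assume neg: "\<not> ?thesis"
  define D where "D = real (\<Sum>k\<in>UNIV. d k)"
  define c where "c = real (card (signs N))"
  have c: "0 < c" using finite_signs signs_nonempty by (simp add: c_def card_gt_0_iff)
  have r: "0 < r" unfolding r_def by simp
  have Xs: "X e k \<in> sym_mats (d k)" for e k unfolding X_def by (rule R_map_sym[OF A])
  note Xc = sym_matsD(1)[OF Xs]
  have mom: "(\<Sum>e\<in>signs N. frobenius_sq (X e k ^\<^sub>m m)) \<le> (\<Prod>i<m. 2 * real i + 1) * t k ^ m * d k * c" for k m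
    unfolding X_def c_def by (rule khintchine_moments[OF A t t0])
  have "r ^ m \<le> (\<Prod>i<m. 2 * real i + 1) * D" for m
  proof -
    let ?p = "\<Prod>i<m. 2 * real i + 1"
    have p: "0 < ?p" by (intro prod_pos) auto
    have low: "r ^ m \<le> (\<Sum>k\<in>UNIV. frobenius_sq (X e k ^\<^sub>m m) / t k ^ m)" if e: "e \<in> signs N" for e
    proof -
      obtain k v where v: "v \<in> carrier_vec (d k)" and
        gt: "r * t k * (v \<bullet> v) < (X e k *\<^sub>v v) \<bullet> (X e k *\<^sub>v v)"
        using neg e by (auto simp: not_le)
      have le: "(X e k ^\<^sub>m j *\<^sub>v v) \<bullet> (X e k ^\<^sub>m j *\<^sub>v v) \<le> frobenius_sq (X e k ^\<^sub>m j) * (v \<bullet> v)" for j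
        by (rule frobenius_sq_mult_mat_vec_le[of _ "d k" "d k"]) (use Xc v in auto)
      \<comment> \<open>If \<open>t k = 0\<close>, the moment bound for \<open>m = 1\<close> makes
        \<open>X e k\<close> vanish, and no vector can violate the constraint.\<close>
      have tk: "0 < t k"
      proof (rule ccontr)
        assume "\<not> 0 < t k"
        then have "t k = 0" using t0[of k] by simp
        then have "(\<Sum>e\<in>signs N. frobenius_sq (X e k ^\<^sub>m 1)) \<le> 0" using mom[of k 1] by simp
        then have "frobenius_sq (X e k ^\<^sub>m 1) = 0"
          using e finite_signs frobenius_sq_nonneg by (metis (mono_tags, lifting) sum_nonneg sum_nonneg_eq_0_iff order_antisym)
        then show False using le[of 1] gt \<open>t k = 0\<close> Xc[of e k] by simp
      qed
      have "v \<bullet> v \<noteq> 0"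
      proof
        assume "v \<bullet> v = 0"
        then show False using le[of 1] gt Xc[of e k] by simp
      qed
      then have vv: "0 < v \<bullet> v" using scalar_prod_self_nonneg[of v] by simp
      have "(r * t k) ^ m * (v \<bullet> v) \<le> frobenius_sq (X e k ^\<^sub>m m) * (v \<bullet> v)"
        using power_mat_vec_growth[OF Xs v, of "r * t k" e m] r t0[of k] gt le[of m] by simp
      then have "(r * t k) ^ m \<le> frobenius_sq (X e k ^\<^sub>m m)" using vv by simp
      then have "r ^ m \<le> frobenius_sq (X e k ^\<^sub>m m) / t k ^ m" using tk by (simp add: field_simps)
      also have "\<dots> \<le> (\<Sum>k\<in>UNIV. frobenius_sq (X e k ^\<^sub>m m) / t k ^ m)"
        by (rule member_le_sum) (use t0 frobenius_sq_nonneg in auto)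
      finally show ?thesis .
    qed
    have "c * r ^ m = (\<Sum>e\<in>signs N. r ^ m)" by (simp add: c_def)
    also have "\<dots> \<le> (\<Sum>e\<in>signs N. \<Sum>k\<in>UNIV. frobenius_sq (X e k ^\<^sub>m m) / t k ^ m)" by (intro sum_mono low)
    also have "\<dots> = (\<Sum>k\<in>UNIV. (\<Sum>e\<in>signs N. frobenius_sq (X e k ^\<^sub>m m)) / t k ^ m)"
      by (subst sum.swap) (simp add: sum_divide_distrib)
    also have "\<dots> \<le> (\<Sum>k\<in>UNIV. ?p * d k * c)"
    proof (rule sum_mono)
      fix k :: 'K
      show "(\<Sum>e\<in>signs N. frobenius_sq (X e k ^\<^sub>m m)) / t k ^ m \<le> ?p * d k * c"
      \<comment> \<open>A zero denominator makes the quotient 0 by convention, and the right-hand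
        side is nonnegative.\<close>
      proof (cases "t k ^ m = 0")
        case True
        then have "(\<Sum>e\<in>signs N. frobenius_sq (X e k ^\<^sub>m m)) / t k ^ m = 0" by (simp only: div_by_0)
        moreover have "0 \<le> ?p * d k * c" using p c by simp
        ultimately show ?thesis by (rule ord_eq_le_trans)
      next
        case False
        then have "0 < t k ^ m" using t0[of k] by (metis zero_le_power order_le_less)
        then show ?thesis using mom[of k m] by (simp add: field_simps)
      qed
    qed
    also have "\<dots> = c * (?p * D)" by (simp add: D_def sum_distrib_left sum_distrib_right algebra_simps)
    finally show ?thesis using c by simp
  qed
  then have lt: "exp (r / 2) < 2 * D" by (rule double_fact_moments_bound[OF r])
  \<comment> \<open>The strict bound supplies the positivity under which \<open>ln (2 * D)\<close>
    is a genuine logarithm.\<close>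
  then have "0 < 2 * D" by (metis exp_gt_zero less_trans)
  then have "r / 2 < ln (2 * D)" using lt by (metis exp_ln exp_less_cancel_iff)
  then show False by (simp add: r_def D_def)
qed

section \<open>Positive semidefinite forms\<close>

text \<open>Tychonoff's theorem for boxes; it serves as Heine-Borel for families of reals, with a
  bound that may depend on the coordinate.\<close>

lemma compact_bounded_coordinates:
  fixes S :: "('i \<Rightarrow> real) set"
  assumes "closed S" "\<And>f i. f \<in> S \<Longrightarrow> \<bar>f i\<bar> \<le> M i"
  shows "compact S"
proof -
  have "compact (PiE UNIV (\<lambda>i. {- M i..M i}))"
    using compactin_PiE[of "\<lambda>_. euclidean" UNIV "\<lambda>i. {- M i..M i}"]
    by (simp add: euclidean_product_topology)
  moreover have "S = PiE UNIV (\<lambda>i. {- M i..M i}) \<inter> S"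
    using assms(2) by (auto simp: abs_le_iff minus_le_iff)
  ultimately show ?thesis using assms(1) by (metis compact_Int_closed)
qed

lemma continuous_on_coordinate [continuous_intros]: "continuous_on S (\<lambda>f. (f :: 'i \<Rightarrow> real) i)"
  by (rule continuous_on_product_then_coordinatewise) (rule continuous_on_id)

lemma continuous_on_snd_coordinate [continuous_intros]:
  "continuous_on S (\<lambda>p. (snd p :: 'i \<Rightarrow> real) i)"
  by (rule continuous_on_product_then_coordinatewise) (intro continuous_intros)

lemma continuous_on_fst_coordinate [continuous_intros]:
  "continuous_on S (\<lambda>p. (fst p :: 'i \<Rightarrow> real) i)"
  by (rule continuous_on_product_then_coordinatewise) (intro continuous_intros)

text \<open>Vectors are total functions here, not \<open>vec\<close>: they can be combined pointwise
  without size conditions and carry the product topology, on which the extremal arguments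
  rely.\<close>

definition bform :: "nat \<Rightarrow> (nat \<Rightarrow> nat \<Rightarrow> real) \<Rightarrow> (nat \<Rightarrow> real) \<Rightarrow> (nat \<Rightarrow> real) \<Rightarrow> real" where
  "bform n Q x y = (\<Sum>i<n. \<Sum>j<n. x i * Q i j * y j)"

lemma bform_add_left: "bform n Q (\<lambda>i. x i + y i) z = bform n Q x z + bform n Q y z"
  and bform_add_right: "bform n Q z (\<lambda>i. x i + y i) = bform n Q z x + bform n Q z y"
  and bform_cmult_left: "bform n Q (\<lambda>i. c * x i) z = c * bform n Q x z"
  and bform_cmult_right: "bform n Q z (\<lambda>i. c * x i) = c * bform n Q z x"
  by (simp_all add: bform_def algebra_simps sum.distrib sum_distrib_left)

lemmas bform_linear = bform_add_left bform_add_right bform_cmult_left bform_cmult_right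

lemma bform_sym:
  assumes "\<And>i j. i < n \<Longrightarrow> j < n \<Longrightarrow> Q i j = Q j i"
  shows "bform n Q x y = bform n Q y x"
proof -
  have "bform n Q x y = (\<Sum>j<n. \<Sum>i<n. x i * Q i j * y j)" unfolding bform_def by (rule sum.swap)
  also have "\<dots> = bform n Q y x"
    unfolding bform_def using assms by (intro sum.cong refl) (auto simp: mult.assoc mult.commute mult.left_commute)
  finally show ?thesis .
qed

lemma bform_delta_right: "m < n \<Longrightarrow> bform n Q x (\<lambda>i. if i = m then 1 else 0) = (\<Sum>i<n. x i * Q i m)"
  by (simp add: bform_def if_distrib[of "\<lambda>z. _ * z"] cong: if_cong)

lemma bform_delta: "m < n \<Longrightarrow> k < n \<Longrightarrow>
    bform n Q (\<lambda>i. if i = k then 1 else 0) (\<lambda>i. if i = m then 1 else 0) = Q k m"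
  by (simp add: bform_delta_right if_distrib[of "\<lambda>z. z * _"] cong: if_cong)

definition psd_form :: "nat \<Rightarrow> (nat \<Rightarrow> nat \<Rightarrow> real) \<Rightarrow> bool" where
  "psd_form n Q \<longleftrightarrow> (\<forall>i<n. \<forall>j<n. Q i j = Q j i) \<and> (\<forall>x. 0 \<le> bform n Q x x)"

lemma bform_perturb:
  assumes "\<And>i j. i < n \<Longrightarrow> j < n \<Longrightarrow> Q i j = Q j i" "m < n"
  shows "bform n Q (\<lambda>i. x i + c * (if i = m then 1 else 0)) (\<lambda>i. x i + c * (if i = m then 1 else 0))
    = bform n Q x x + 2 * c * (\<Sum>i<n. x i * Q i m) + c\<^sup>2 * Q m m"
proof -
  define e :: "nat \<Rightarrow> real" where "e = (\<lambda>i. if i = m then 1 else 0)"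
  have "bform n Q x e = (\<Sum>i<n. x i * Q i m)" unfolding e_def by (rule bform_delta_right[OF assms(2)])
  moreover have "bform n Q e e = Q m m" unfolding e_def by (rule bform_delta[OF assms(2,2)])
  moreover have "bform n Q e x = bform n Q x e" by (rule bform_sym[OF assms(1)])
  ultimately have "bform n Q (\<lambda>i. x i + c * e i) (\<lambda>i. x i + c * e i)
      = bform n Q x x + 2 * c * (\<Sum>i<n. x i * Q i m) + c\<^sup>2 * Q m m"
    by (simp add: bform_linear power2_eq_square algebra_simps)
  then show ?thesis by (simp add: e_def)
qed

section \<open>Cholesky factors and orthogonal factorisations\<close>

lemma linear_nonneg_imp_0:
  fixes a b :: real
  assumes "\<And>r. 0 \<le> a + r * b"
  shows "b = 0"
proof (rule ccontr)
  assume "b \<noteq> 0"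
  then show False using assms[of "- (a + 1) / b"] by simp
qed

text \<open>One step of the Cholesky factorisation, leaving a Schur complement. If
  \<open>Q m m = 0\<close>, the divisions give 0 and nothing is subtracted, which is right because
  the whole column then vanishes.\<close>

lemma psd_form_peel:
  assumes Q: "psd_form n Q" and "m < n"
  defines "Q' \<equiv> \<lambda>a b. Q a b - (Q a m / sqrt (Q m m)) * (Q b m / sqrt (Q m m))"
  shows "psd_form n Q'" "\<And>b. b < n \<Longrightarrow> Q' m b = 0"
proof -
  have sym: "Q i j = Q j i" if "i < n" "j < n" for i j using Q that by (simp add: psd_form_def)
  have pos: "0 \<le> bform n Q x x" for x using Q by (simp add: psd_form_def)
  have mm: "0 \<le> Q m m" using pos[of "\<lambda>i. if i = m then 1 else 0"] \<open>m < n\<close> by (simp add: bform_delta)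
  have zero: "Q b m = 0" if "Q m m = 0" "b < n" for b
  proof -
    \<comment> \<open>With \<open>Q m m = 0\<close> the form at e_b + r e_m is affine in
      \<open>r\<close>; being nonnegative, it has slope 0.\<close>
    have "0 \<le> Q b b + r * (2 * Q b m)" for r
      using pos[of "\<lambda>i. (if i = b then 1 else 0) + r * (if i = m then 1 else 0)"] that \<open>m < n\<close>
      by (simp add: bform_perturb[OF sym \<open>m < n\<close>] bform_delta if_distrib[of "\<lambda>z. z * _"] cong: if_cong)
    then show ?thesis using linear_nonneg_imp_0[of "Q b b" "2 * Q b m"] by simp
  qed
  have Q': "Q' a b = Q a b - Q a m * Q b m / Q m m" for a b
    using mm by (simp add: Q'_def)
  show "Q' m b = 0" if "b < n" for b
    using zero[OF _ that] sym[OF that \<open>m < n\<close>] by (cases "Q m m = 0") (simp_all add: Q')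
  have "0 \<le> bform n Q' x x" for x
  proof -
    define \<beta> where "\<beta> = (\<Sum>i<n. x i * Q i m)"
    have "bform n Q' x x = bform n Q x x - (\<Sum>i<n. \<Sum>j<n. (x i * Q i m) * (x j * Q j m)) / Q m m"
      by (simp add: bform_def Q' algebra_simps sum_subtractf sum_divide_distrib)
    also have "(\<Sum>i<n. \<Sum>j<n. (x i * Q i m) * (x j * Q j m)) = \<beta>\<^sup>2"
      by (simp add: \<beta>_def power2_eq_square sum_product)
    \<comment> \<open>Completing the square: this is the value of the form at \<open>x\<close>
      shifted by \<open>- \<beta> / Q m m\<close> along coordinate \<open>m\<close>.\<close>
    also have "bform n Q x x - \<beta>\<^sup>2 / Q m m
      = bform n Q x x + 2 * (- \<beta> / Q m m) * \<beta> + (- \<beta> / Q m m)\<^sup>2 * Q m m"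
      by (cases "Q m m = 0") (simp_all add: field_simps power2_eq_square)
    also have "\<dots> \<ge> 0"
      unfolding \<beta>_def by (subst bform_perturb[symmetric]) (use sym pos \<open>m < n\<close> in auto)
    finally show ?thesis .
  qed
  moreover have "Q' i j = Q' j i" if "i < n" "j < n" for i j using sym[OF that] by (simp add: Q' mult.commute)
  ultimately show "psd_form n Q'" by (simp add: psd_form_def)
qed

text \<open>Cholesky by repeated peeling. The invariant records that the remainder is positive
  semidefinite and that its first \<open>m\<close> rows vanish; after \<open>n\<close> steps nothing
  remains.\<close>

lemma psd_form_gram:
  assumes "psd_form n Q"
  shows "\<exists>q. \<forall>a<n. \<forall>b<n. Q a b = (\<Sum>j<n. q j a * q j b)"
proof -
  have "\<exists>q. psd_form n (\<lambda>a b. Q a b - (\<Sum>j<m. q j a * q j b)) \<and>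
      (\<forall>a<m. \<forall>b<n. Q a b = (\<Sum>j<m. q j a * q j b))" if "m \<le> n" for m
    using that
  proof (induction m)
    case 0
    then show ?case using assms by simp
  next
    case (Suc m)
    then obtain q where q: "psd_form n (\<lambda>a b. Q a b - (\<Sum>j<m. q j a * q j b))"
      "\<forall>a<m. \<forall>b<n. Q a b = (\<Sum>j<m. q j a * q j b)" by auto
    define Q0 where "Q0 = (\<lambda>a b. Q a b - (\<Sum>j<m. q j a * q j b))"
    define q' where "q' = q(m := \<lambda>a. Q0 a m / sqrt (Q0 m m))"
    have m: "m < n" using Suc by simp
    have eq: "Q a b - (\<Sum>j<Suc m. q' j a * q' j b)
      = Q0 a b - (Q0 a m / sqrt (Q0 m m)) * (Q0 b m / sqrt (Q0 m m))" for a b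
      by (simp add: q'_def Q0_def)
    note peel = psd_form_peel[OF q(1)[folded Q0_def] m]
    have "Q a b = (\<Sum>j<Suc m. q' j a * q' j b)" if "a < Suc m" "b < n" for a b
    proof (cases "a = m")
      case True
      have "Q m b - (\<Sum>j<Suc m. q' j m * q' j b) = 0" unfolding eq by (rule peel(2)[OF that(2)])
      then show ?thesis using True by simp
    next
      case False
      then have "a < m" using that by simp
      \<comment> \<open>Rows cleared earlier have entry 0 in column \<open>m\<close>, so the new
        vector does not disturb them.\<close>
      then have "Q0 a m = 0" using q(2) m by (simp add: Q0_def)
      then show ?thesis using \<open>a < m\<close> q(2) that by (simp add: q'_def)
    qed
    moreover have "psd_form n (\<lambda>a b. Q a b - (\<Sum>j<Suc m. q' j a * q' j b))"
      unfolding eq by (rule peel(1))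
    ultimately show ?case by blast
  qed
  from this[of n] show ?thesis by auto
qed

text \<open>The rotation diagonalises the symmetric matrix with diagonal a, b and off-diagonal entry
  h. It keeps a + b and turns a - b into \<open>r\<close>, the difference of the eigenvalues, so the
  sum of squares grows by 2 h^2.\<close>

lemma jacobi_rotation:
  fixes a b h :: real
  assumes "h \<noteq> 0"
  shows "\<exists>c s. c\<^sup>2 + s\<^sup>2 = 1 \<and>
    a\<^sup>2 + b\<^sup>2 < (c\<^sup>2 * a + 2 * c * s * h + s\<^sup>2 * b)\<^sup>2 + (s\<^sup>2 * a - 2 * c * s * h + c\<^sup>2 * b)\<^sup>2"
proof -
  define r where "r = sqrt ((a - b)\<^sup>2 + (2 * h)\<^sup>2)"
  have r2: "r\<^sup>2 = (a - b)\<^sup>2 + (2 * h)\<^sup>2" by (simp add: r_def)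
  have "0 < r" using assms by (simp add: r_def add_nonneg_pos)
  have "((a - b) / r)\<^sup>2 + (2 * h / r)\<^sup>2 = 1"
    unfolding power_divide add_divide_distrib[symmetric] r2[symmetric] using \<open>0 < r\<close> by simp
  then obtain x where x: "(a - b) / r = cos x" "2 * h / r = sin x"
    using sincos_total_2pi by metis
  \<comment> \<open>Half the angle of the vector (a - b, 2h), since double angles occur in the
    rotated diagonal.\<close>
  define c s where "c = cos (x / 2)" and "s = sin (x / 2)"
  have cs: "c\<^sup>2 + s\<^sup>2 = 1" by (simp add: c_def s_def)
  have "cos x = c\<^sup>2 - s\<^sup>2" "sin x = 2 * s * c"
    using cos_double[of "x / 2"] sin_double[of "x / 2"] by (simp_all add: c_def s_def)
  moreover have "a - b = r * cos x" "2 * h = r * sin x"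
    unfolding x[symmetric] using \<open>0 < r\<close> by simp_all
  ultimately have ab: "a - b = r * (c\<^sup>2 - s\<^sup>2)" and h: "2 * h = r * (2 * s * c)"
    by (simp_all only:)
  let ?A = "c\<^sup>2 * a + 2 * c * s * h + s\<^sup>2 * b" and ?B = "s\<^sup>2 * a - 2 * c * s * h + c\<^sup>2 * b"
  have "?A + ?B = (c\<^sup>2 + s\<^sup>2) * (a + b)" by (simp add: algebra_simps)
  then have sum: "?A + ?B = a + b" using cs by simp
  have "?A - ?B = (c\<^sup>2 - s\<^sup>2) * (a - b) + 2 * s * c * (2 * h)" by (simp add: algebra_simps)
  also have "\<dots> = r * ((c\<^sup>2 - s\<^sup>2)\<^sup>2 + (2 * s * c)\<^sup>2)" unfolding ab h by (simp add: power2_eq_square algebra_simps)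
  also have "(c\<^sup>2 - s\<^sup>2)\<^sup>2 + (2 * s * c)\<^sup>2 = (c\<^sup>2 + s\<^sup>2)\<^sup>2" by (simp add: power2_eq_square algebra_simps)
  finally have diff: "?A - ?B = r" using cs by simp
  have par: "2 * (u\<^sup>2 + v\<^sup>2) = (u + v)\<^sup>2 + (u - v)\<^sup>2" for u v :: real
    by (simp add: power2_eq_square algebra_simps)
  have "2 * (?A\<^sup>2 + ?B\<^sup>2) = (a + b)\<^sup>2 + r\<^sup>2" unfolding par[of ?A ?B] sum diff ..
  also have "\<dots> = 2 * (a\<^sup>2 + b\<^sup>2) + (2 * h)\<^sup>2" unfolding r2 par by simp
  finally have "2 * (?A\<^sup>2 + ?B\<^sup>2) = 2 * (a\<^sup>2 + b\<^sup>2) + (2 * h)\<^sup>2" .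
  moreover have "0 < (2 * h)\<^sup>2" using assms by simp
  moreover have "u < v" if "2 * v = 2 * u + w" "0 < w" for u v w :: real using that by linarith
  ultimately have "a\<^sup>2 + b\<^sup>2 < ?A\<^sup>2 + ?B\<^sup>2" by blast
  with cs show ?thesis by blast
qed

text \<open>Jacobi's method as an extremal argument: among all q' with the given Gram matrix, the one that
  maximises the sum of squares of the diagonal entries is orthogonal, since otherwise a plane rotation
  would increase this sum.\<close>

lemma gram_diagonalize:
  fixes B :: "nat \<Rightarrow> nat \<Rightarrow> real" and q :: "nat \<Rightarrow> nat \<Rightarrow> real"
  assumes B: "\<And>i j. i < n \<Longrightarrow> j < n \<Longrightarrow> B i j = B j i"
  shows "\<exists>q'. (\<forall>a<n. \<forall>b<n. (\<Sum>j<n. q' j a * q' j b) = (\<Sum>j<n. q j a * q j b)) \<and>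
    (\<forall>i<n. \<forall>j<n. i \<noteq> j \<longrightarrow> bform n B (q' i) (q' j) = 0)"
proof -
  define G where "G a b = (\<Sum>j<n. q j a * q j b)" for a b
  \<comment> \<open>All factorisations of \<open>G\<close>, extended by 0 outside the index range;
    the diagonal of \<open>G\<close> bounds every entry, which gives compactness.\<close>
  define Z where "Z = {f :: nat \<times> nat \<Rightarrow> real. (\<forall>p. p \<notin> {..<n} \<times> {..<n} \<longrightarrow> f p = 0) \<and>
      (\<forall>a b. a < n \<longrightarrow> b < n \<longrightarrow> (\<Sum>j<n. f (j, a) * f (j, b)) = G a b)}"
  define rw where "rw f j a = f (j, a)" for f :: "nat \<times> nat \<Rightarrow> real" and j a
  define \<Phi> where "\<Phi> f = (\<Sum>i<n. (bform n B (rw f i) (rw f i))\<^sup>2)" for f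
  have cZ: "compact Z"
  proof (rule compact_bounded_coordinates)
    show "closed Z"
      unfolding Z_def
      by (intro closed_Collect_conj closed_Collect_all closed_Collect_imp open_Collect_const
          closed_Collect_eq continuous_intros)
    fix f p assume f: "f \<in> Z"
    show "\<bar>f p\<bar> \<le> sqrt (\<Sum>a<n. G a a)"
    proof (cases "p \<in> {..<n} \<times> {..<n}")
      case True
      then obtain j a where p: "p = (j, a)" "j < n" "a < n" by auto
      have Gs: "G c c = (\<Sum>j<n. (f (j, c))\<^sup>2)" if "c < n" for c
        using f that by (simp add: Z_def power2_eq_square)
      have "(f p)\<^sup>2 \<le> G a a" unfolding Gs[OF p(3)] p(1) by (rule member_le_sum) (use p in auto)
      also have "\<dots> \<le> (\<Sum>a<n. G a a)"
        by (rule member_le_sum) (use p Gs in \<open>auto intro: sum_nonneg\<close>)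
      finally show ?thesis by (simp add: real_le_rsqrt)
    next
      case False
      have "0 \<le> (\<Sum>a<n. G a a)" by (auto simp: G_def intro!: sum_nonneg)
      then show ?thesis using f False by (cases p) (auto simp: Z_def)
    qed
  qed
  have "(\<lambda>(j, a). if j < n \<and> a < n then q j a else 0) \<in> Z" by (auto simp: Z_def G_def)
  then have "Z \<noteq> {}" by blast
  moreover have "continuous_on Z \<Phi>" unfolding \<Phi>_def bform_def rw_def by (intro continuous_intros)
  ultimately obtain f where f: "f \<in> Z" "\<And>g. g \<in> Z \<Longrightarrow> \<Phi> g \<le> \<Phi> f"
    using continuous_attains_sup[OF cZ] by metis
  have "bform n B (rw f i) (rw f j) = 0" if ij: "i < n" "j < n" "i \<noteq> j" for i j
  proof (rule ccontr)
    define a b h where "a = bform n B (rw f i) (rw f i)" and "b = bform n B (rw f j) (rw f j)"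
      and "h = bform n B (rw f i) (rw f j)"
    assume "bform n B (rw f i) (rw f j) \<noteq> 0"
    then obtain c s where cs: "c\<^sup>2 + s\<^sup>2 = 1" and
      gt: "a\<^sup>2 + b\<^sup>2 < (c\<^sup>2 * a + 2 * c * s * h + s\<^sup>2 * b)\<^sup>2 + (s\<^sup>2 * a - 2 * c * s * h + c\<^sup>2 * b)\<^sup>2"
      using jacobi_rotation[of h a b] by (auto simp: h_def)
    \<comment> \<open>Rows \<open>i\<close> and \<open>j\<close> are rotated; an orthogonal
      combination of rows leaves the Gram matrix unchanged.\<close>
    define g where "g = (\<lambda>(k, l). if k = i then c * f (i, l) + s * f (j, l)
      else if k = j then (- s) * f (i, l) + c * f (j, l) else f (k, l))"
    have split: "(\<Sum>k<n. F k) = F i + F j + (\<Sum>k\<in>{..<n} - {i, j}. F k)" for F :: "nat \<Rightarrow> real"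
      using ij sum.subset_diff[of "{i, j}" "{..<n}" F] by simp
    have "(\<Sum>k<n. g (k, l) * g (k, m)) = (\<Sum>k<n. f (k, l) * f (k, m))" for l m
    proof -
      have "g (i, l) * g (i, m) + g (j, l) * g (j, m)
        = (c\<^sup>2 + s\<^sup>2) * (f (i, l) * f (i, m) + f (j, l) * f (j, m))"
        using ij(3) by (simp add: g_def power2_eq_square algebra_simps)
      then have "g (i, l) * g (i, m) + g (j, l) * g (j, m) = f (i, l) * f (i, m) + f (j, l) * f (j, m)"
        using cs by simp
      moreover have "(\<Sum>k\<in>{..<n} - {i, j}. g (k, l) * g (k, m)) = (\<Sum>k\<in>{..<n} - {i, j}. f (k, l) * f (k, m))"
        by (intro sum.cong) (auto simp: g_def)
      ultimately show ?thesis unfolding split by simp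
    qed
    then have "g \<in> Z" using f(1) ij by (auto simp: Z_def g_def)
    have hs: "bform n B (rw f j) (rw f i) = h" unfolding h_def by (rule bform_sym[OF B])
    have ri: "rw g i = (\<lambda>l. c * rw f i l + s * rw f j l)" by (simp add: rw_def g_def fun_eq_iff)
    have rj: "rw g j = (\<lambda>l. (- s) * rw f i l + c * rw f j l)" using ij(3) by (simp add: rw_def g_def fun_eq_iff)
    have gi: "bform n B (rw g i) (rw g i) = c\<^sup>2 * a + 2 * c * s * h + s\<^sup>2 * b"
      unfolding ri bform_linear hs a_def[symmetric] b_def[symmetric] h_def[symmetric]
      by (simp add: power2_eq_square algebra_simps)
    have gj: "bform n B (rw g j) (rw g j) = s\<^sup>2 * a - 2 * c * s * h + c\<^sup>2 * b"
      unfolding rj bform_linear hs a_def[symmetric] b_def[symmetric] h_def[symmetric]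
      by (simp add: power2_eq_square algebra_simps)
    have "rw g k = rw f k" if "k \<noteq> i" "k \<noteq> j" for k using that by (simp add: rw_def g_def fun_eq_iff)
    then have "(\<Sum>k\<in>{..<n} - {i, j}. (bform n B (rw g k) (rw g k))\<^sup>2)
        = (\<Sum>k\<in>{..<n} - {i, j}. (bform n B (rw f k) (rw f k))\<^sup>2)"
      by (intro sum.cong refl) auto
    then have "\<Phi> f < \<Phi> g" unfolding \<Phi>_def split gi gj using gt by (simp add: a_def b_def)
    with f(2)[OF \<open>g \<in> Z\<close>] show False by simp
  qed
  moreover have "(\<Sum>j<n. rw f j a * rw f j b) = G a b" if "a < n" "b < n" for a b
    using f(1) that by (simp add: Z_def rw_def)
  ultimately show ?thesis unfolding G_def by (intro exI[of _ "rw f"]) blast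
qed

section \<open>Matrix inequalities in terms of quadratic forms\<close>

lemma quad_eq_bform: "A \<in> carrier_mat n n \<Longrightarrow> quad A (Matrix.vec n x) = bform n (\<lambda>i j. A $$ (i, j)) x x"
  by (simp add: quad_eq_sum[of _ n] bform_def)

lemma vec_of_index: "v \<in> carrier_vec n \<Longrightarrow> Matrix.vec n (\<lambda>i. v $ i) = v"
  by (intro eq_vecI) auto

lemma psd_iff_psd_form:
  assumes "A \<in> carrier_mat n n"
  shows "psd A \<longleftrightarrow> psd_form n (\<lambda>i j. A $$ (i, j))"
proof -
  have "A \<in> sym_mats n \<longleftrightarrow> (\<forall>i<n. \<forall>j<n. A $$ (i, j) = A $$ (j, i))"
    using assms sym_matsI sym_matsD(3) by metis
  moreover have "(\<forall>v\<in>carrier_vec n. 0 \<le> quad A v) \<longleftrightarrow> (\<forall>x. 0 \<le> bform n (\<lambda>i j. A $$ (i, j)) x x)"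
    by (metis assms quad_eq_bform vec_of_index vec_carrier)
  ultimately show ?thesis using assms by (simp add: psd_def psd_form_def)
qed

lemma loewner_le_iff_psd_form:
  assumes "A \<in> carrier_mat n n" "B \<in> carrier_mat n n"
  shows "loewner_le A B \<longleftrightarrow> psd_form n (\<lambda>i j. B $$ (i, j) - A $$ (i, j))"
proof -
  have "psd (B - A) \<longleftrightarrow> psd_form n (\<lambda>i j. (B - A) $$ (i, j))"
    by (rule psd_iff_psd_form) (use assms in auto)
  also have "\<dots> \<longleftrightarrow> psd_form n (\<lambda>i j. B $$ (i, j) - A $$ (i, j))"
    using assms by (simp add: psd_form_def bform_def)
  finally show ?thesis using assms by (simp add: loewner_le_def)
qed

text \<open>Symmetry of \<open>M\<close> turns v^T M^2 v into a squared norm. In this form the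
  constraints pass to sums over signs and to quadratic forms in y.\<close>

lemma loewner_le_square_iff:
  assumes M: "M \<in> sym_mats d"
  shows "loewner_le (M * M) (t \<cdot>\<^sub>m 1\<^sub>m d) \<longleftrightarrow>
    (\<forall>v\<in>carrier_vec d. (M *\<^sub>v v) \<bullet> (M *\<^sub>v v) \<le> t * (v \<bullet> v))"
proof -
  note Mc = sym_matsD(1)[OF M]
  let ?A = "t \<cdot>\<^sub>m 1\<^sub>m d - M * M"
  have "?A \<in> sym_mats d"
  proof -
    have "transpose_mat ?A = ?A"
      using Mc sym_matsD(2)[OF M]
      by (subst transpose_minus[of _ d d]) (auto simp: transpose_mult[of _ d d _ d] mult_carrier_mat[of _ d d _ d])
    then show ?thesis using Mc by (simp add: sym_mats_def minus_carrier_mat mult_carrier_mat[of _ d d _ d])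
  qed
  moreover have "quad ?A v = t * (v \<bullet> v) - (M *\<^sub>v v) \<bullet> (M *\<^sub>v v)" if v: "v \<in> carrier_vec d" for v
  proof -
    have "?A *\<^sub>v v = t \<cdot>\<^sub>v v - M *\<^sub>v (M *\<^sub>v v)"
      using Mc v by (subst minus_mult_distrib_mat_vec[of _ d d]) (auto simp: mult_carrier_mat[of _ d d _ d]
          assoc_mult_mat_vec[of _ d d _ d])
    then have "quad ?A v = v \<bullet> (t \<cdot>\<^sub>v v) - v \<bullet> (M *\<^sub>v (M *\<^sub>v v))"
      unfolding quad_def using Mc v by (simp add: scalar_prod_minus_distrib[of _ d])
    then show ?thesis
      using sym_mat_scalar_prod[OF M v, of "M *\<^sub>v v"] Mc v by simp
  qed
  ultimately show ?thesis using Mc by (simp add: loewner_le_def psd_def)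
qed

text \<open>Both sides are the trace of A Q. The left-hand side thus depends on the vectors only
  through their Gram matrix, which permits exchanging one factorisation for another.\<close>

lemma sum_bform_gram:
  assumes "\<And>a b. a < n \<Longrightarrow> b < n \<Longrightarrow> Q a b = (\<Sum>j<m. q j a * q j b)"
  shows "(\<Sum>j<m. bform n A (q j) (q j)) = (\<Sum>a<n. \<Sum>b<n. A a b * Q a b)"
proof -
  have "(\<Sum>j<m. bform n A (q j) (q j)) = (\<Sum>a<n. \<Sum>j<m. \<Sum>b<n. q j a * A a b * q j b)"
    unfolding bform_def by (rule sum.swap)
  also have "\<dots> = (\<Sum>a<n. \<Sum>b<n. \<Sum>j<m. q j a * A a b * q j b)"
    by (intro sum.cong refl sum.swap)
  also have "\<dots> = (\<Sum>a<n. \<Sum>b<n. A a b * Q a b)"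
    using assms by (intro sum.cong refl) (simp add: sum_distrib_left algebra_simps)
  finally show ?thesis .
qed

lemma psd_form_diag_nonneg: "psd_form n Q \<Longrightarrow> a < n \<Longrightarrow> 0 \<le> Q a a"
  unfolding psd_form_def by (metis bform_delta)

text \<open>In a Gram factorisation 2|xy| <= x^2 + y^2 bounds an entry by two diagonal ones; so
  bounded traces give bounded multipliers.\<close>

lemma psd_form_entry_le:
  assumes "psd_form n Q" "a < n" "b < n"
  shows "\<bar>Q a b\<bar> \<le> (\<Sum>c<n. Q c c)"
proof -
  obtain q where q: "\<And>a b. a < n \<Longrightarrow> b < n \<Longrightarrow> Q a b = (\<Sum>j<n. q j a * q j b)"
    using psd_form_gram[OF assms(1)] by blast
  have ineq: "\<bar>x * y\<bar> \<le> (x * x + y * y) / 2" for x y :: real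
    using sum_squares_bound[of "\<bar>x\<bar>" "\<bar>y\<bar>"] by (simp add: abs_mult power2_eq_square)
  have "\<bar>Q a b\<bar> \<le> (\<Sum>j<n. \<bar>q j a * q j b\<bar>)" unfolding q[OF assms(2,3)] by (rule sum_abs)
  also have "\<dots> \<le> (\<Sum>j<n. (q j a * q j a + q j b * q j b) / 2)" by (intro sum_mono ineq)
  also have "\<dots> = (Q a a + Q b b) / 2" by (simp add: q assms sum.distrib sum_divide_distrib[symmetric])
  also have "\<dots> \<le> (\<Sum>c<n. Q c c)"
  proof -
    have "Q c c \<le> (\<Sum>c<n. Q c c)" if "c < n" for c
      using that by (intro member_le_sum) (auto intro: psd_form_diag_nonneg[OF assms(1)])
    from this[OF assms(2)] this[OF assms(3)] show ?thesis by simp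
  qed
  finally show ?thesis .
qed

text \<open>A Gram factorisation of \<open>L\<close> writes the trace of \<open>L\<close> times the
  psd matrix t I - M^2 as a sum of nonnegative values of the form of the latter.\<close>

lemma psd_form_mat_trace_mult_le:
  assumes L: "psd_form d (\<lambda>a b. L $$ (a, b))" "L \<in> carrier_mat d d" and M: "M \<in> sym_mats d"
    and t: "\<And>v. v \<in> carrier_vec d \<Longrightarrow> (M *\<^sub>v v) \<bullet> (M *\<^sub>v v) \<le> t * (v \<bullet> v)"
  shows "mat_trace (L * (M * M)) \<le> t * mat_trace L"
proof -
  note Mc = sym_matsD(1)[OF M]
  have "loewner_le (M * M) (t \<cdot>\<^sub>m 1\<^sub>m d)" using loewner_le_square_iff[OF M] t by blast
  then have le: "psd_form d (\<lambda>i j. (t \<cdot>\<^sub>m 1\<^sub>m d) $$ (i, j) - (M * M) $$ (i, j))"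
    by (subst (asm) loewner_le_iff_psd_form[of _ d]) (use Mc in auto)
  obtain q where q: "\<And>a b. a < d \<Longrightarrow> b < d \<Longrightarrow> L $$ (a, b) = (\<Sum>j<d. q j a * q j b)"
    using psd_form_gram[OF L(1)] by blast
  have sq: "L $$ (a, b) = L $$ (b, a)" if "a < d" "b < d" for a b using L(1) that by (simp add: psd_form_def)
  have "0 \<le> (\<Sum>j<d. bform d (\<lambda>i j. (t \<cdot>\<^sub>m 1\<^sub>m d) $$ (i, j) - (M * M) $$ (i, j)) (q j) (q j))"
    using le by (intro sum_nonneg) (auto simp: psd_form_def)
  also have "\<dots> = (\<Sum>a<d. \<Sum>b<d. ((t \<cdot>\<^sub>m 1\<^sub>m d) $$ (a, b) - (M * M) $$ (a, b)) * L $$ (a, b))"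
    by (rule sum_bform_gram[OF q])
  also have "\<dots> = (\<Sum>a<d. \<Sum>b<d. (if a = b then t * L $$ (a, b) else 0) - L $$ (b, a) * (M * M) $$ (a, b))"
    using sq by (intro sum.cong refl) (auto simp: algebra_simps simp del: index_mult_mat)
  also have "\<dots> = (\<Sum>a<d. t * L $$ (a, a)) - (\<Sum>a<d. \<Sum>b<d. L $$ (b, a) * (M * M) $$ (a, b))"
    by (simp add: sum_subtractf del: index_mult_mat)
  also have "(\<Sum>a<d. \<Sum>b<d. L $$ (b, a) * (M * M) $$ (a, b)) = mat_trace (L * (M * M))"
    using L(2) Mc by (subst mat_trace_mult[of _ d d]) (auto intro: sum.swap simp del: index_mult_mat)
  also have "(\<Sum>a<d. t * L $$ (a, a)) = t * mat_trace L"
    using L(2) by (simp add: mat_trace_def sum_distrib_left)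
  finally show ?thesis by simp
qed

text \<open>For fixed \<open>v\<close> the squared norm is a quadratic form in the coefficients,
  with the Gram matrix of the vectors \<open>S i *\<^sub>v v\<close>. The spectratope constraint
  thereby becomes linear in x x^T.\<close>

lemma R_map_sq_eq_bform:
  assumes "\<And>i. i < n \<Longrightarrow> S i \<in> carrier_mat m m" "v \<in> carrier_vec m"
  shows "(R_map m n S (Matrix.vec n x) *\<^sub>v v) \<bullet> (R_map m n S (Matrix.vec n x) *\<^sub>v v)
    = bform n (\<lambda>i j. (S i *\<^sub>v v) \<bullet> (S j *\<^sub>v v)) x x"
proof -
  let ?M = "R_map m n S (Matrix.vec n x)"
  have idx: "(?M *\<^sub>v v) $ a = (\<Sum>i<n. x i * (S i *\<^sub>v v) $ a)" if a: "a < m" for a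
  proof -
    have "(?M *\<^sub>v v) $ a = (\<Sum>b<m. \<Sum>i<n. x i * (S i $$ (a, b) * v $ b))"
      using a assms by (simp add: mult_mat_vec_index[of _ m m] sum_distrib_right mult.assoc del: index_mult_mat_vec)
    also have "\<dots> = (\<Sum>i<n. \<Sum>b<m. x i * (S i $$ (a, b) * v $ b))" by (rule sum.swap)
    also have "\<dots> = (\<Sum>i<n. x i * (S i *\<^sub>v v) $ a)"
      using a assms by (simp add: mult_mat_vec_index[of _ m m] sum_distrib_left del: index_mult_mat_vec)
    finally show ?thesis .
  qed
  have "(?M *\<^sub>v v) \<bullet> (?M *\<^sub>v v) = (\<Sum>a<m. (\<Sum>i<n. x i * (S i *\<^sub>v v) $ a) * (\<Sum>i<n. x i * (S i *\<^sub>v v) $ a))"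
    by (subst scalar_prod_eq_sum[of _ m]) (auto simp: idx carrier_vecI simp del: index_mult_mat_vec)
  also have "\<dots> = (\<Sum>a<m. \<Sum>i<n. \<Sum>j<n. x i * ((S i *\<^sub>v v) $ a * (S j *\<^sub>v v) $ a) * x j)"
    unfolding sum_product by (simp add: algebra_simps)
  also have "\<dots> = (\<Sum>i<n. \<Sum>a<m. \<Sum>j<n. x i * ((S i *\<^sub>v v) $ a * (S j *\<^sub>v v) $ a) * x j)" by (rule sum.swap)
  also have "\<dots> = (\<Sum>i<n. \<Sum>j<n. \<Sum>a<m. x i * ((S i *\<^sub>v v) $ a * (S j *\<^sub>v v) $ a) * x j)"
    by (intro sum.cong refl sum.swap)
  also have "\<dots> = bform n (\<lambda>i j. (S i *\<^sub>v v) \<bullet> (S j *\<^sub>v v)) x x"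
    unfolding bform_def
  proof (intro sum.cong refl)
    fix i j assume "i \<in> {..<n}" "j \<in> {..<n}"
    then have "S j *\<^sub>v v \<in> carrier_vec m" using assms by (auto intro: mult_mat_vec_carrier)
    then show "(\<Sum>a<m. x i * ((S i *\<^sub>v v) $ a * (S j *\<^sub>v v) $ a) * x j) = x i * ((S i *\<^sub>v v) \<bullet> (S j *\<^sub>v v)) * x j"
      by (simp add: scalar_prod_eq_sum[of _ m] sum_distrib_left sum_distrib_right)
  qed
  finally show ?thesis .
qed

lemma R_map_R_map:
  "R_map m N (\<lambda>j. R_map m n S (Matrix.vec n (q j))) (Matrix.vec N e)
    = R_map m n S (Matrix.vec n (\<lambda>a. \<Sum>j<N. e j * q j a))"
proof (rule eq_matI; simp)
  fix a b
  have "(\<Sum>j<N. e j * (\<Sum>i<n. q j i * S i $$ (a, b))) = (\<Sum>j<N. \<Sum>i<n. e j * q j i * S i $$ (a, b))"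
    by (simp add: sum_distrib_left mult.assoc)
  also have "\<dots> = (\<Sum>i<n. (\<Sum>j<N. e j * q j i) * S i $$ (a, b))"
    by (subst sum.swap) (simp add: sum_distrib_right)
  finally show "(\<Sum>j<N. e j * (\<Sum>i<n. q j i * S i $$ (a, b))) = (\<Sum>i<n. (\<Sum>j<N. e j * q j i) * S i $$ (a, b))" .
qed

lemma R_adj_index:
  assumes "\<And>i. i < n \<Longrightarrow> S i \<in> carrier_mat m m" "L \<in> carrier_mat m m" "i < n" "j < n"
  shows "R_adj n S L $$ (i, j) = (\<Sum>a<m. \<Sum>b<m. L $$ (a, b) * ((S i * S j + S j * S i) $$ (b, a) / 2))"
  using assms
  by (simp add: R_adj_def mat_trace_mult[of _ m m] add_carrier_mat mult_carrier_mat[of _ m m _ m]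
      sum_divide_distrib[symmetric] del: index_mult_mat index_add_mat)

text \<open>The adjoint relation, obtained by expanding both factors in \<open>x\<close>. The
  symmetrised product in \<open>R_adj\<close> does not change the quadratic form.\<close>

lemma bform_R_adj:
  assumes S: "\<And>i. i < n \<Longrightarrow> S i \<in> carrier_mat m m" and L: "L \<in> carrier_mat m m"
  defines "M \<equiv> \<lambda>x. R_map m n S (Matrix.vec n x)"
  shows "bform n (\<lambda>i j. R_adj n S L $$ (i, j)) x x = mat_trace (L * (M x * M x))"
proof -
  note [simp] = mult_carrier_mat[of _ m m _ m] L
  have Mc [simp]: "M x \<in> carrier_mat m m" by (simp add: M_def)
  define \<tau> where "\<tau> i j = mat_trace (L * (S i * S j))" for i j
  have adj: "R_adj n S L $$ (i, j) = (\<tau> i j + \<tau> j i) / 2" if "i < n" "j < n" for i j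
  proof -
    have "mat_trace (A + B) = mat_trace A + mat_trace B" if "A \<in> carrier_mat m m" "B \<in> carrier_mat m m" for A B
      using that by (simp add: mat_trace_def sum.distrib)
    then show ?thesis
      using S that by (simp add: R_adj_def \<tau>_def mult_add_distrib_mat[of _ m m _ m])
  qed
  have "mat_trace (L * (M x * M x)) = mat_trace (M x * (M x * L))"
    using mat_trace_comm[of L m m "M x * M x"] by (simp add: assoc_mult_mat[of _ m m _ m _ m])
  also have "\<dots> = (\<Sum>i<n. x i * mat_trace (S i * (M x * L)))"
    using S by (subst (1) M_def, subst mat_trace_R_map_mult) auto
  also have "\<dots> = (\<Sum>i<n. x i * mat_trace (M x * (L * S i)))"
    using S mat_trace_comm[of _ m m "M x * L"]
    by (intro sum.cong refl) (simp add: assoc_mult_mat[of _ m m _ m _ m])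
  also have "\<dots> = (\<Sum>i<n. x i * (\<Sum>j<n. x j * mat_trace (S j * (L * S i))))"
    using S by (intro sum.cong refl arg_cong[of _ _ "(*) _"], subst (1) M_def, subst mat_trace_R_map_mult) auto
  also have "\<dots> = (\<Sum>i<n. \<Sum>j<n. x i * \<tau> i j * x j)"
  proof (unfold sum_distrib_left, intro sum.cong refl)
    fix i j assume ij: "i \<in> {..<n}" "j \<in> {..<n}"
    have "mat_trace (S j * (L * S i)) = \<tau> i j"
      unfolding \<tau>_def using S ij mat_trace_comm[of "S j" m m "L * S i"] by (simp add: assoc_mult_mat[of _ m m _ m _ m])
    then show "x i * (x j * mat_trace (S j * (L * S i))) = x i * \<tau> i j * x j" by simp
  qed
  also have "\<dots> = bform n \<tau> x x" by (simp add: bform_def)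
  also have "bform n \<tau> x x = bform n (\<lambda>i j. R_adj n S L $$ (i, j)) x x"
  proof -
    have "2 * bform n (\<lambda>i j. R_adj n S L $$ (i, j)) x x
        = (\<Sum>i<n. \<Sum>j<n. x i * \<tau> i j * x j) + (\<Sum>i<n. \<Sum>j<n. x i * \<tau> j i * x j)"
      unfolding bform_def sum_distrib_left sum.distrib[symmetric]
      by (intro sum.cong refl) (simp add: adj algebra_simps add_divide_distrib)
    also have "(\<Sum>i<n. \<Sum>j<n. x i * \<tau> j i * x j) = bform n \<tau> x x"
      unfolding bform_def by (subst sum.swap) (simp add: mult.assoc mult.commute mult.left_commute)
    finally show ?thesis by (simp add: bform_def)
  qed
  finally show ?thesis by simp
qed

lemma R_adj_index_sym: "i < n \<Longrightarrow> j < n \<Longrightarrow> dim_col L = dim_row (S i) \<Longrightarrow> S i \<in> carrier_mat m m \<Longrightarrow> S j \<in> carrier_mat m m \<Longrightarrow>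
    R_adj n S L $$ (i, j) = R_adj n S L $$ (j, i)"
  by (simp add: R_adj_def comm_add_mat[of "S i * S j" m m] mult_carrier_mat[of _ m m _ m])

section \<open>Monotonic sets, their support functions and a bipolar theorem\<close>

lemma monotonic_setD:
  assumes "monotonic_set T"
  shows "convex T" "compact T" "\<And>t k. t \<in> T \<Longrightarrow> 0 \<le> vec_nth t k" "\<exists>t\<in>T. \<forall>k. 0 < vec_nth t k"
    "\<And>t t'. t \<in> T \<Longrightarrow> (\<And>k. 0 \<le> vec_nth t' k \<and> vec_nth t' k \<le> vec_nth t k) \<Longrightarrow> t' \<in> T"
    "T \<noteq> {}" "0 \<in> T"
proof -
  show 1: "convex T" "compact T" "\<And>t k. t \<in> T \<Longrightarrow> 0 \<le> vec_nth t k" "\<exists>t\<in>T. \<forall>k. 0 < vec_nth t k"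
    "\<And>t t'. t \<in> T \<Longrightarrow> (\<And>k. 0 \<le> vec_nth t' k \<and> vec_nth t' k \<le> vec_nth t k) \<Longrightarrow> t' \<in> T"
    using assms unfolding monotonic_set_def by blast+
  show "T \<noteq> {}" using 1(4) by blast
  then obtain t where "t \<in> T" by blast
  then show "0 \<in> T" using 1(3) 1(5)[of t 0] by simp
qed

lemma phi_ge:
  assumes "compact T" "t \<in> T"
  shows "inner g t \<le> phi T g"
  using phi_is_max[OF assms(1), of g] assms(2) by (metis empty_iff)

lemma phi_le:
  assumes "compact T" "T \<noteq> {}" "\<And>t. t \<in> T \<Longrightarrow> inner g t \<le> c"
  shows "phi T g \<le> c"
  using phi_is_max[of T g] assms by auto

lemma phi_mono:
  assumes "monotonic_set T" "\<And>k. vec_nth g k \<le> vec_nth h k"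
  shows "phi T g \<le> phi T h"
proof (rule phi_le)
  fix t assume t: "t \<in> T"
  have "inner g t \<le> inner h t"
    unfolding inner_vec_def by (intro sum_mono) (use assms monotonic_setD(3)[OF assms(1) t] in \<open>auto intro: mult_right_mono\<close>)
  also have "\<dots> \<le> phi T h" by (rule phi_ge[OF monotonic_setD(2)[OF assms(1)] t])
  finally show "inner g t \<le> phi T h" .
qed (fact monotonic_setD(2)[OF assms(1)], fact monotonic_setD(6)[OF assms(1)])

lemma convex_on_phi:
  assumes "compact T" "T \<noteq> {}"
  shows "convex_on UNIV (phi T)"
proof (rule convex_onI)
  fix s :: real and x y assume s: "0 < s" "s < 1"
  show "phi T ((1 - s) *\<^sub>R x + s *\<^sub>R y) \<le> (1 - s) * phi T x + s * phi T y"
  proof (rule phi_le[OF assms])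
    fix t assume "t \<in> T"
    then show "inner ((1 - s) *\<^sub>R x + s *\<^sub>R y) t \<le> (1 - s) * phi T x + s * phi T y"
      using s by (auto simp: inner_add_left intro!: add_mono mult_left_mono phi_ge[OF assms(1)])
  qed
qed simp

lemma continuous_on_phi:
  assumes "compact T" "T \<noteq> {}"
  shows "continuous_on UNIV (phi T)"
  using convex_on_continuous[OF open_UNIV convex_on_phi[OF assms]] .

lemma phi_scaleR_le:
  assumes "compact T" "T \<noteq> {}" "0 \<le> c"
  shows "phi T (c *\<^sub>R g) \<le> c * phi T g"
  using assms by (intro phi_le) (auto intro: mult_left_mono phi_ge)

text \<open>A bipolar theorem in which nonnegative functionals suffice: the negated separating
  normal is replaced by its positive part \<open>h\<close>. By monotonicity this does not raise the
  maximum over \<open>T\<close>, and at the nonnegative point \<open>z\<close> the value can only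
  grow.\<close>

lemma mem_monotonic_set_polar:
  fixes T :: "(real ^ 'K::finite) set"
  assumes T: "monotonic_set T" and z: "\<And>k. 0 \<le> vec_nth z k" and "0 < \<gamma>"
    and polar: "\<And>g. (\<And>k. 0 \<le> vec_nth g k) \<Longrightarrow> phi T g \<le> \<gamma> \<Longrightarrow> inner g z \<le> \<gamma>"
  shows "z \<in> T"
proof (rule ccontr)
  note Tc = monotonic_setD(2)[OF T] and T0 = monotonic_setD(6)[OF T]
  assume "z \<notin> T"
  then obtain a b where ab: "inner a z < b" "\<And>x. x \<in> T \<Longrightarrow> b < inner a x"
    using separating_hyperplane_closed_point[of T z] monotonic_setD(1)[OF T] compact_imp_closed[OF Tc] by blast
  define h :: "real ^ 'K" where "h = (\<chi> k. max 0 (- vec_nth a k))"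
  \<comment> \<open>The origin lies in \<open>T\<close>, so the separating level is negative and can
    be used for scaling.\<close>
  have "0 < - b" using ab(2)[OF monotonic_setD(7)[OF T]] by simp
  have hT: "phi T h \<le> - b"
  proof (rule phi_le[OF Tc T0])
    fix t assume t: "t \<in> T"
    \<comment> \<open>Coordinates with positive \<open>a\<close> are set to 0: monotonicity keeps
      the point in \<open>T\<close>, and on the others \<open>h\<close> agrees with the negated
      normal.\<close>
    define t' :: "real ^ 'K" where "t' = (\<chi> k. if vec_nth a k \<le> 0 then vec_nth t k else 0)"
    have "t' \<in> T" by (rule monotonic_setD(5)[OF T t]) (simp add: t'_def monotonic_setD(3)[OF T t])
    moreover have "inner h t = - inner a t'"
      unfolding inner_vec_def h_def t'_def by (auto simp: sum_negf[symmetric] max_def intro!: sum.cong)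
    ultimately show "inner h t \<le> - b" using ab(2)[of t'] by simp
  qed
  have hz: "- b < inner h z"
  proof -
    have "- (x * y) \<le> max 0 (- x) * y" if "0 \<le> y" for x y :: real
      using mult_right_mono[of "- x" "max 0 (- x)" y] that by simp
    then have "- inner a z \<le> inner h z"
      unfolding inner_vec_def h_def sum_negf[symmetric] by (intro sum_mono) (simp add: z)
    then show ?thesis using ab(1) by simp
  qed
  \<comment> \<open>The factor normalises \<open>h\<close> to the level required by
    \<open>polar\<close>, while the strict inequality at \<open>z\<close> survives.\<close>
  have "phi T ((\<gamma> / - b) *\<^sub>R h) \<le> (\<gamma> / - b) * phi T h"
    using \<open>0 < \<gamma>\<close> \<open>0 < - b\<close> by (intro phi_scaleR_le[OF Tc T0] divide_nonneg_nonneg) auto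
  also have "\<dots> \<le> (\<gamma> / - b) * (- b)"
    using \<open>0 < \<gamma>\<close> \<open>0 < - b\<close> by (intro mult_left_mono hT divide_nonneg_nonneg) auto
  also have "\<dots> = \<gamma>" using \<open>0 < - b\<close> by simp
  finally have "phi T ((\<gamma> / - b) *\<^sub>R h) \<le> \<gamma>" .
  moreover have "0 \<le> vec_nth ((\<gamma> / - b) *\<^sub>R h) k" for k
    using \<open>0 < \<gamma>\<close> \<open>0 < - b\<close> by (auto simp: h_def intro!: mult_nonneg_nonneg divide_nonneg_nonneg simp del: divide_minus_right)
  ultimately have "(\<gamma> / - b) * inner h z \<le> \<gamma>" using polar[of "(\<gamma> / - b) *\<^sub>R h"] by simp
  moreover have "(\<gamma> / - b) * (- b) < (\<gamma> / - b) * inner h z"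
    using \<open>0 < \<gamma>\<close> \<open>0 < - b\<close> by (intro mult_strict_left_mono hz divide_pos_pos) auto
  ultimately show False using \<open>0 < - b\<close> by simp
qed

section \<open>First-order conditions and extremal directions\<close>

lemma directional_nonneg:
  fixes a b :: real
  assumes "\<And>s. 0 < s \<Longrightarrow> s \<le> 1 \<Longrightarrow> 0 \<le> 2 * s * a + s\<^sup>2 * b"
  shows "0 \<le> a"
proof (rule ccontr)
  assume a: "\<not> 0 \<le> a"
  \<comment> \<open>Small enough that \<open>s * b\<close> is at most \<open>- a\<close>, so the
    linear term wins; the minimum with 1 keeps \<open>s\<close> admissible.\<close>
  define s where "s = min 1 (- a / (\<bar>b\<bar> + 1))"
  have s: "0 < s" "s \<le> 1" using a by (simp_all add: s_def divide_pos_pos del: divide_minus_left)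
  have "s * b \<le> s * (\<bar>b\<bar> + 1)" using s by (intro mult_left_mono) auto
  also have "\<dots> \<le> (- a / (\<bar>b\<bar> + 1)) * (\<bar>b\<bar> + 1)" by (intro mult_right_mono) (auto simp: s_def)
  also have "\<dots> = - a" by simp
  finally have "2 * a + s * b < 0" using a by simp
  moreover have "2 * s * a + s\<^sup>2 * b = s * (2 * a + s * b)" by (simp add: power2_eq_square algebra_simps)
  ultimately show False using assms[OF s] s by (simp add: zero_le_mult_iff)
qed

text \<open>First-order optimality in a least-squares problem: \<open>G\<close> is the minimal
  residual, \<open>H\<close> an admissible direction.\<close>

lemma sum_sq_variation_nonneg:
  fixes G H :: "nat \<Rightarrow> nat \<Rightarrow> real"
  assumes "\<And>s. 0 < s \<Longrightarrow> s \<le> 1 \<Longrightarrow>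
    (\<Sum>i<n. \<Sum>j<n. (G i j)\<^sup>2) \<le> (\<Sum>i<n. \<Sum>j<n. (G i j + s * H i j)\<^sup>2)"
  shows "0 \<le> (\<Sum>i<n. \<Sum>j<n. G i j * H i j)"
proof (rule directional_nonneg)
  fix s :: real assume "0 < s" "s \<le> 1"
  note le = assms[OF this]
  have "(\<Sum>i<n. \<Sum>j<n. (G i j + s * H i j)\<^sup>2) = (\<Sum>i<n. \<Sum>j<n. (G i j)\<^sup>2)
      + 2 * s * (\<Sum>i<n. \<Sum>j<n. G i j * H i j) + s\<^sup>2 * (\<Sum>i<n. \<Sum>j<n. (H i j)\<^sup>2)"
    by (simp add: power2_eq_square algebra_simps sum.distrib sum_distrib_left)
  with le show "0 \<le> 2 * s * (\<Sum>i<n. \<Sum>j<n. G i j * H i j) + s\<^sup>2 * (\<Sum>i<n. \<Sum>j<n. (H i j)\<^sup>2)"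
    by simp
qed

lemma psd_form_add: "psd_form n Q \<Longrightarrow> psd_form n Q' \<Longrightarrow> psd_form n (\<lambda>i j. Q i j + Q' i j)"
  by (auto simp: psd_form_def bform_def distrib_left distrib_right sum.distrib intro!: add_nonneg_nonneg)

lemma bform_scale: "bform n (\<lambda>i j. c * Q i j) x y = c * bform n Q x y"
  by (simp add: bform_def sum_distrib_left algebra_simps)

lemma psd_form_scale: "0 \<le> c \<Longrightarrow> psd_form n Q \<Longrightarrow> psd_form n (\<lambda>i j. c * Q i j)"
  by (auto simp: psd_form_def bform_scale)

lemma psd_form_cong: "(\<And>i j. i < n \<Longrightarrow> j < n \<Longrightarrow> Q i j = Q' i j) \<Longrightarrow> psd_form n Q \<longleftrightarrow> psd_form n Q'"
  by (simp add: psd_form_def bform_def)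

lemma bform_rank_one: "bform n (\<lambda>i j. x i * x j) y y = (\<Sum>i<n. x i * y i)\<^sup>2"
  by (simp add: bform_def power2_eq_square sum_product algebra_simps)

lemma psd_form_rank_one: "psd_form n (\<lambda>i j. x i * x j)"
  unfolding psd_form_def bform_rank_one by (simp add: mult.commute)

lemma closed_Collect_psd_form:
  assumes "\<And>i j. continuous_on UNIV (\<lambda>p. Q p i j)"
  shows "closed {p. psd_form n (Q p)}"
  unfolding psd_form_def bform_def
  by (intro closed_Collect_conj closed_Collect_all closed_Collect_imp open_Collect_const
      closed_Collect_eq closed_Collect_le continuous_intros assms)

text \<open>A maximiser on the unit ball provides the largest eigenvalue without spectral theory.
  The ball, unlike the sphere, is nonempty in dimension 0, and blocks may have size 0.\<close>

lemma bform_max_direction: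
  assumes "psd_form n Q"
  shows "\<exists>u. (\<Sum>i<n. (u i)\<^sup>2) \<le> 1 \<and> (\<forall>v. bform n Q v v \<le> bform n Q u u * (\<Sum>i<n. (v i)\<^sup>2))"
proof -
  define Z where "Z = {u :: nat \<Rightarrow> real. (\<forall>i. i \<notin> {..<n} \<longrightarrow> u i = 0) \<and> (\<Sum>i<n. (u i)\<^sup>2) \<le> 1}"
  have "compact Z"
  proof (rule compact_bounded_coordinates)
    show "closed Z" unfolding Z_def
      by (intro closed_Collect_conj closed_Collect_all closed_Collect_imp open_Collect_const
          closed_Collect_eq closed_Collect_le continuous_intros)
    fix u i assume u: "u \<in> Z"
    show "\<bar>u i\<bar> \<le> 1"
    proof (cases "i < n")
      case True
      then have "(u i)\<^sup>2 \<le> (\<Sum>i<n. (u i)\<^sup>2)" by (intro member_le_sum) auto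
      then have "(u i)\<^sup>2 \<le> 1" using u by (simp add: Z_def)
      then show ?thesis by (simp add: abs_square_le_1)
    qed (use u in \<open>auto simp: Z_def\<close>)
  qed
  moreover have "(\<lambda>_. 0) \<in> Z" by (simp add: Z_def)
  then have "Z \<noteq> {}" by blast
  moreover have "continuous_on Z (\<lambda>u. bform n Q u u)" unfolding bform_def by (intro continuous_intros)
  ultimately have "\<exists>u\<in>Z. \<forall>v\<in>Z. bform n Q v v \<le> bform n Q u u" by (rule continuous_attains_sup)
  then obtain u where u: "u \<in> Z" "\<And>v. v \<in> Z \<Longrightarrow> bform n Q v v \<le> bform n Q u u" by blast
  have "bform n Q v v \<le> bform n Q u u * (\<Sum>i<n. (v i)\<^sup>2)" for v
  proof (cases "(\<Sum>i<n. (v i)\<^sup>2) = 0")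
    case True
    then have "\<forall>i<n. v i = 0" by (subst (asm) sum_nonneg_eq_0_iff) auto
    then show ?thesis by (simp add: bform_def)
  next
    case False
    define s where "s = (\<Sum>i<n. (v i)\<^sup>2)"
    have s: "0 < s" using False by (simp add: s_def sum_nonneg order_less_le)
    define w where "w i = (if i < n then (1 / sqrt s) * v i else 0)" for i
    have "(\<Sum>i<n. (w i)\<^sup>2) = (\<Sum>i<n. (v i)\<^sup>2 / s)"
      using s by (intro sum.cong) (auto simp: w_def power_divide)
    also have "\<dots> = 1" using s by (simp add: sum_divide_distrib[symmetric] s_def[symmetric])
    finally have "w \<in> Z" by (simp add: Z_def w_def)
    have "bform n Q w w = bform n Q (\<lambda>i. (1 / sqrt s) * v i) (\<lambda>i. (1 / sqrt s) * v i)"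
      by (simp add: bform_def w_def)
    also have "\<dots> = (1 / sqrt s) * ((1 / sqrt s) * bform n Q v v)" by (simp only: bform_cmult_left bform_cmult_right)
    also have "\<dots> = bform n Q v v / s" using s by simp
    finally have "bform n Q v v / s \<le> bform n Q u u" using u(2)[OF \<open>w \<in> Z\<close>] by simp
    then show ?thesis using s unfolding s_def[symmetric] by (simp add: field_simps)
  qed
  then show ?thesis using u(1) by (auto simp: Z_def)
qed

section \<open>The multipliers of the relaxation as a compact convex set\<close>

locale spectratope_data =
  fixes n :: nat and d :: "'K::finite \<Rightarrow> nat" and R :: "'K \<Rightarrow> nat \<Rightarrow> real mat" and T :: "(real ^ 'K) set"
  assumes R: "i < n \<Longrightarrow> R k i \<in> sym_mats (d k)"
    and T: "monotonic_set T"
begin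

lemmas T_compact = monotonic_setD(2)[OF T]
  and T_nonneg = monotonic_setD(3)[OF T] and T_ne = monotonic_setD(6)[OF T]

lemma Rc: "i < n \<Longrightarrow> R k i \<in> carrier_mat (d k) (d k)"
  using R by (rule sym_matsD(1))

definition Rm :: "'K \<Rightarrow> (nat \<Rightarrow> real) \<Rightarrow> real mat" where
  "Rm k x = R_map (d k) n (R k) (Matrix.vec n x)"

lemma Rm_sym: "Rm k x \<in> sym_mats (d k)"
  unfolding Rm_def by (rule R_map_sym[OF R])

lemmas Rm_carrier = sym_matsD(1)[OF Rm_sym]

definition Rsq :: "'K \<Rightarrow> real Matrix.vec \<Rightarrow> nat \<Rightarrow> nat \<Rightarrow> real" where
  "Rsq k v i j = (R k i *\<^sub>v v) \<bullet> (R k j *\<^sub>v v)"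

lemma Rm_sq: "v \<in> carrier_vec (d k) \<Longrightarrow> (Rm k x *\<^sub>v v) \<bullet> (Rm k x *\<^sub>v v) = bform n (Rsq k v) x x"
  unfolding Rm_def Rsq_def by (rule R_map_sq_eq_bform[OF Rc])

text \<open>The tuple \<open>\<Lambda>\<close> is encoded by one function on triples (k, a, b) that vanishes outside the index ranges,
  because compactness is then available from the product topology.\<close>

definition mat_of :: "('K \<times> nat \<times> nat \<Rightarrow> real) \<Rightarrow> 'K \<Rightarrow> real mat" where
  "mat_of f k = Matrix.mat (d k) (d k) (\<lambda>(a, b). f (k, a, b))"

lemma mat_of_carrier [simp]: "mat_of f k \<in> carrier_mat (d k) (d k)"
  by (simp add: mat_of_def)

text \<open>The sum of the adjoints applied to the multipliers, expanded in entries so that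
  linearity and continuity in \<open>f\<close> are visible.\<close>

definition Aop :: "('K \<times> nat \<times> nat \<Rightarrow> real) \<Rightarrow> nat \<Rightarrow> nat \<Rightarrow> real" where
  "Aop f i j = (\<Sum>k\<in>UNIV. \<Sum>a<d k. \<Sum>b<d k. f (k, a, b) * ((R k i * R k j + R k j * R k i) $$ (b, a) / 2))"

lemma Aop_eq: "i < n \<Longrightarrow> j < n \<Longrightarrow> Aop f i j = (\<Sum>k\<in>UNIV. R_adj n (R k) (mat_of f k) $$ (i, j))"
  unfolding Aop_def using Rc
  by (intro sum.cong refl) (subst R_adj_index[of _ _ "d _"], auto simp: mat_of_def simp del: index_add_mat index_mult_mat)

lemma Aop_affine: "Aop (\<lambda>p. f p + s * (f' p - f p)) i j = Aop f i j + s * (Aop f' i j - Aop f i j)"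
  unfolding Aop_def
  by (simp add: algebra_simps sum.distrib sum_subtractf sum_distrib_left add_divide_distrib diff_divide_distrib
      del: index_add_mat index_mult_mat)

lemma Aop_sym: "i < n \<Longrightarrow> j < n \<Longrightarrow> Aop f i j = Aop f j i"
  using carrier_matD[OF Rc]
  by (simp add: Aop_eq R_adj_index_sym[OF _ _ _ Rc Rc] mat_of_def)

lemma bform_Aop: "bform n (Aop f) x x = (\<Sum>k\<in>UNIV. mat_trace (mat_of f k * (Rm k x * Rm k x)))"
proof -
  have "bform n (Aop f) x x = (\<Sum>i<n. \<Sum>k\<in>UNIV. \<Sum>j<n. x i * R_adj n (R k) (mat_of f k) $$ (i, j) * x j)"
    unfolding bform_def
    by (intro sum.cong refl, subst sum.swap, intro sum.cong refl) (simp add: Aop_eq sum_distrib_left sum_distrib_right)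
  also have "\<dots> = (\<Sum>k\<in>UNIV. bform n (\<lambda>i j. R_adj n (R k) (mat_of f k) $$ (i, j)) x x)"
    unfolding bform_def by (rule sum.swap)
  also have "\<dots> = (\<Sum>k\<in>UNIV. mat_trace (mat_of f k * (Rm k x * Rm k x)))"
    unfolding Rm_def by (intro sum.cong refl bform_R_adj Rc) auto
  finally show ?thesis .
qed

lemma continuous_on_Aop:
  assumes "continuous_on S g"
  shows "continuous_on S (\<lambda>p. Aop (g p) i j)"
  unfolding Aop_def by (intro continuous_intros continuous_on_product_then_coordinatewise[OF assms])

definition lam :: "('K \<times> nat \<times> nat \<Rightarrow> real) \<Rightarrow> real ^ 'K" where
  "lam f = (\<chi> k. \<Sum>a<d k. f (k, a, a))"

lemma lam_eq: "lam f = lambda_vec (mat_of f)"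
  by (simp add: lam_def lambda_vec_def mat_trace_def mat_of_def)

lemma continuous_on_phi_lam: "continuous_on UNIV (\<lambda>f. phi T (lam f))"
  by (rule continuous_on_compose2[OF continuous_on_phi[OF T_compact T_ne]])
     (auto simp: lam_def intro!: continuous_intros)

text \<open>Multipliers of objective value at most \<gamma>; the inequality involving P^T C P is
  left out, as it is the target of the projection argument.\<close>

definition Lset :: "real \<Rightarrow> ('K \<times> nat \<times> nat \<Rightarrow> real) set" where
  "Lset \<gamma> = {f. (\<forall>k a b. \<not> (a < d k \<and> b < d k) \<longrightarrow> f (k, a, b) = 0) \<and>
     (\<forall>k. psd_form (d k) (\<lambda>a b. f (k, a, b))) \<and> phi T (lam f) \<le> \<gamma>}"

text \<open>A point of \<open>T\<close> with positive entries turns the bound on \<open>phi\<close>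
  into a bound on each trace, and the trace of a psd matrix bounds its entries.\<close>

lemma compact_Lset: "compact (Lset \<gamma>)"
proof -
  obtain t where t: "t \<in> T" "\<And>k. 0 < vec_nth t k" using monotonic_setD(4)[OF T] by blast
  show ?thesis
  proof (rule compact_bounded_coordinates)
    show "closed (Lset \<gamma>)"
      unfolding Lset_def
      by (intro closed_Collect_conj closed_Collect_all closed_Collect_imp open_Collect_const closed_Collect_psd_form
          closed_Collect_eq closed_Collect_le continuous_on_phi_lam continuous_intros)
    fix f and p :: "'K \<times> nat \<times> nat" assume f: "f \<in> Lset \<gamma>"
    obtain k a b where p: "p = (k, a, b)" by (cases p)
    have tr: "0 \<le> vec_nth (lam f) k" for k
      using f by (auto simp: lam_def Lset_def intro!: sum_nonneg psd_form_diag_nonneg[of "d k" "\<lambda>a b. f (k, a, b)"])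
    have "vec_nth (lam f) k * vec_nth t k \<le> (\<Sum>k\<in>UNIV. vec_nth (lam f) k * vec_nth t k)"
      by (intro member_le_sum) (simp_all add: tr less_imp_le[OF t(2)])
    also have "\<dots> = inner (lam f) t" by (simp add: inner_vec_def)
    also have "\<dots> \<le> phi T (lam f)" by (rule phi_ge[OF T_compact t(1)])
    also have "\<dots> \<le> \<gamma>" using f by (simp add: Lset_def)
    finally have le: "vec_nth (lam f) k \<le> \<gamma> / vec_nth t k" using t(2)[of k] by (simp add: field_simps)
    have "\<bar>f (k, a, b)\<bar> \<le> vec_nth (lam f) k"
    proof (cases "a < d k \<and> b < d k")
      case True
      then show ?thesis
        using f psd_form_entry_le[of "d k" "\<lambda>a b. f (k, a, b)" a b] by (simp add: lam_def Lset_def)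
    next
      case False
      then have "f (k, a, b) = 0" using f unfolding Lset_def by blast
      then show ?thesis using tr[of k] by simp
    qed
    then show "\<bar>f p\<bar> \<le> (\<lambda>(k, a, b). \<gamma> / vec_nth t k) p" using le p by simp
  qed
qed

lemma Lset_convex:
  assumes "f \<in> Lset \<gamma>" "f' \<in> Lset \<gamma>" "0 \<le> s" "s \<le> 1"
  shows "(\<lambda>p. f p + s * (f' p - f p)) \<in> Lset \<gamma>"
proof -
  have eq: "(\<lambda>p. f p + s * (f' p - f p)) = (\<lambda>p. (1 - s) * f p + s * f' p)" by (simp add: algebra_simps)
  have "lam (\<lambda>p. (1 - s) * f p + s * f' p) = (1 - s) *\<^sub>R lam f + s *\<^sub>R lam f'"
    by (simp add: lam_def Finite_Cartesian_Product.vec_eq_iff sum.distrib sum_distrib_left)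
  moreover have "phi T ((1 - s) *\<^sub>R lam f + s *\<^sub>R lam f') \<le> (1 - s) * phi T (lam f) + s * phi T (lam f')"
    using assms convex_on_phi[OF T_compact T_ne] by (intro convex_onD) auto
  moreover have "(1 - s) * phi T (lam f) + s * phi T (lam f') \<le> (1 - s) * \<gamma> + s * \<gamma>"
    using assms by (intro add_mono mult_left_mono) (auto simp: Lset_def)
  moreover have "(1 - s) * \<gamma> + s * \<gamma> = \<gamma>" by (simp add: algebra_simps)
  ultimately have "phi T (lam (\<lambda>p. (1 - s) * f p + s * f' p)) \<le> \<gamma>" by simp
  then show ?thesis
    unfolding eq using assms by (auto simp: Lset_def intro!: psd_form_add psd_form_scale)
qed

end

section \<open>Duality\<close>

context spectratope_data
begin

text \<open>The same number read in two ways, as a form in \<open>v\<close> and as a form in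
  \<open>x\<close>. This links the eigenvalues of R_k[Q] with the primal constraint.\<close>

lemma square_form: "bform (d k) (\<lambda>a b. (Rm k x * Rm k x) $$ (a, b)) v v = bform n (Rsq k (Matrix.vec (d k) v)) x x"
proof -
  let ?v = "Matrix.vec (d k) v"
  have "bform (d k) (\<lambda>a b. (Rm k x * Rm k x) $$ (a, b)) v v = quad (Rm k x * Rm k x) ?v"
    using Rm_carrier by (intro quad_eq_bform[symmetric]) (auto intro: mult_carrier_mat)
  also have "\<dots> = ?v \<bullet> (Rm k x *\<^sub>v (Rm k x *\<^sub>v ?v))"
    using Rm_carrier by (simp add: quad_def assoc_mult_mat_vec[of _ "d k" "d k" _ "d k"])
  also have "\<dots> = (Rm k x *\<^sub>v ?v) \<bullet> (Rm k x *\<^sub>v ?v)"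
    using sym_mat_scalar_prod[OF Rm_sym, of ?v k "Rm k x *\<^sub>v ?v" x]
      mult_mat_vec_carrier[OF Rm_carrier, of ?v k x] by simp
  also have "\<dots> = bform n (Rsq k ?v) x x" by (rule Rm_sq) simp
  finally show ?thesis .
qed

lemma square_form_psd: "psd_form (d k) (\<lambda>a b. (Rm k x * Rm k x) $$ (a, b))"
proof -
  have "transpose_mat (Rm k x * Rm k x) = Rm k x * Rm k x"
    using transpose_mult[OF Rm_carrier[of k x] Rm_carrier[of k x]] sym_matsD(2)[OF Rm_sym[of k x]] by simp
  then have "Rm k x * Rm k x \<in> sym_mats (d k)"
    using Rm_carrier by (auto simp: sym_mats_def intro: mult_carrier_mat)
  moreover have "0 \<le> bform (d k) (\<lambda>a b. (Rm k x * Rm k x) $$ (a, b)) v v" for v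
    unfolding square_form by (subst Rm_sq[symmetric]) (auto intro: scalar_prod_self_nonneg)
  ultimately show ?thesis using sym_matsD(3) by (simp add: psd_form_def del: index_mult_mat)
qed

text \<open>The best multipliers of rank one: \<open>\<mu>\<close> collects the largest eigenvalues of the forms
  \<open>v \<mapsto> \<Sum>\<^sub>j \<parallel>R\<^sub>k[q\<^sub>j] v\<parallel>\<^sup>2\<close>.\<close>

lemma top_eigenvalues:
  fixes q :: "nat \<Rightarrow> nat \<Rightarrow> real"
  shows "\<exists>\<mu> :: real ^ 'K. (\<forall>k. 0 \<le> vec_nth \<mu> k) \<and>
    (\<forall>k. \<forall>v\<in>carrier_vec (d k). (\<Sum>j<n. bform n (Rsq k v) (q j) (q j)) \<le> vec_nth \<mu> k * (v \<bullet> v)) \<and>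
    (\<forall>g \<gamma>. (\<forall>k. 0 \<le> vec_nth g k) \<longrightarrow> phi T g \<le> \<gamma> \<longrightarrow>
      (\<exists>f\<in>Lset \<gamma>. (\<Sum>j<n. bform n (Aop f) (q j) (q j)) = inner g \<mu>))"
proof -
  \<comment> \<open>The matrix R_k[Q], for Q the sum of the q_j q_j^T.\<close>
  define N where "N k a b = (\<Sum>j<n. (Rm k (q j) * Rm k (q j)) $$ (a, b))" for k a b
  have bN: "bform (d k) (N k) v v = (\<Sum>j<n. bform n (Rsq k (Matrix.vec (d k) v)) (q j) (q j))" for k v
  proof -
    have "bform (d k) (N k) v v
        = (\<Sum>a<d k. \<Sum>b<d k. \<Sum>j<n. v a * (Rm k (q j) * Rm k (q j)) $$ (a, b) * v b)"
      unfolding bform_def N_def by (simp only: sum_distrib_left sum_distrib_right)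
    also have "\<dots> = (\<Sum>a<d k. \<Sum>j<n. \<Sum>b<d k. v a * (Rm k (q j) * Rm k (q j)) $$ (a, b) * v b)"
      by (intro sum.cong refl sum.swap)
    also have "\<dots> = (\<Sum>j<n. bform (d k) (\<lambda>a b. (Rm k (q j) * Rm k (q j)) $$ (a, b)) v v)"
      unfolding bform_def by (rule sum.swap)
    finally show ?thesis unfolding square_form .
  qed
  have Npsd: "psd_form (d k) (N k)" for k
    unfolding psd_form_def
  proof (intro conjI allI impI)
    show "N k a b = N k b a" if "a < d k" "b < d k" for a b
      unfolding N_def using square_form_psd that by (intro sum.cong refl) (auto simp: psd_form_def)
    show "0 \<le> bform (d k) (N k) v v" for v
      unfolding bN by (intro sum_nonneg, subst Rm_sq[symmetric]) (auto intro: scalar_prod_self_nonneg)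
  qed
  obtain u where u: "\<And>k. (\<Sum>a<d k. (u k a)\<^sup>2) \<le> 1"
    "\<And>k v. bform (d k) (N k) v v \<le> bform (d k) (N k) (u k) (u k) * (\<Sum>a<d k. (v a)\<^sup>2)"
    using bform_max_direction[OF Npsd] by metis
  define \<mu> :: "real ^ 'K" where "\<mu> = (\<chi> k. bform (d k) (N k) (u k) (u k))"
  have 1: "0 \<le> vec_nth \<mu> k" for k using Npsd by (simp add: \<mu>_def psd_form_def)
  have 2: "(\<Sum>j<n. bform n (Rsq k v) (q j) (q j)) \<le> vec_nth \<mu> k * (v \<bullet> v)" if v: "v \<in> carrier_vec (d k)" for k v
    using u(2)[of k "\<lambda>a. v $ a"] v
    by (simp add: bN vec_of_index \<mu>_def scalar_prod_eq_sum[of _ "d k"] power2_eq_square)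
  have 3: "\<exists>f\<in>Lset \<gamma>. (\<Sum>j<n. bform n (Aop f) (q j) (q j)) = inner g \<mu>"
    if g: "\<And>k. 0 \<le> vec_nth g k" "phi T g \<le> \<gamma>" for g \<gamma>
  proof
    \<comment> \<open>The multiplier g_k u_k u_k^T. Since \<open>u k\<close> has norm at most 1, its
      trace is at most g_k, and monotonicity of \<open>phi\<close> keeps the value within
      \<gamma>.\<close>
    define f where "f = (\<lambda>(k, a, b). if a < d k \<and> b < d k then vec_nth g k * (u k a * u k b) else 0)"
    have "vec_nth (lam f) k \<le> vec_nth g k" for k
    proof -
      have "vec_nth (lam f) k = vec_nth g k * (\<Sum>a<d k. (u k a)\<^sup>2)"
        by (simp add: lam_def f_def sum_distrib_left power2_eq_square)
      also have "\<dots> \<le> vec_nth g k * 1" by (intro mult_left_mono u g)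
      finally show ?thesis by simp
    qed
    then have "phi T (lam f) \<le> \<gamma>" using phi_mono[OF T, of "lam f" g] g(2) by simp
    moreover have "psd_form (d k) (\<lambda>a b. f (k, a, b))" for k
      using psd_form_scale[OF g(1)[of k] psd_form_rank_one[of "d k" "u k"]]
      by (subst psd_form_cong[of _ _ "\<lambda>a b. vec_nth g k * (u k a * u k b)"]) (auto simp: f_def)
    ultimately show "f \<in> Lset \<gamma>" by (auto simp: Lset_def f_def)
    have tr: "mat_trace (mat_of f k * M) = vec_nth g k * bform (d k) (\<lambda>a b. M $$ (a, b)) (u k) (u k)"
      if "M \<in> carrier_mat (d k) (d k)" for k M
    proof -
      have "mat_trace (mat_of f k * M) = (\<Sum>a<d k. \<Sum>b<d k. vec_nth g k * (u k a * u k b) * M $$ (b, a))"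
        using that by (subst mat_trace_mult[of _ "d k" "d k"]) (auto simp: mat_of_def f_def)
      also have "\<dots> = (\<Sum>b<d k. \<Sum>a<d k. vec_nth g k * (u k a * u k b) * M $$ (b, a))" by (rule sum.swap)
      finally show ?thesis by (simp add: bform_def sum_distrib_left algebra_simps)
    qed
    have "(\<Sum>j<n. bform n (Aop f) (q j) (q j)) = (\<Sum>j<n. \<Sum>k\<in>UNIV. vec_nth g k
        * bform (d k) (\<lambda>a b. (Rm k (q j) * Rm k (q j)) $$ (a, b)) (u k) (u k))"
      unfolding bform_Aop using Rm_carrier by (intro sum.cong refl tr) (auto intro: mult_carrier_mat)
    also have "\<dots> = (\<Sum>k\<in>UNIV. vec_nth g k * bform (d k) (N k) (u k) (u k))"
      by (subst sum.swap) (simp add: bN square_form sum_distrib_left)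
    finally show "(\<Sum>j<n. bform n (Aop f) (q j) (q j)) = inner g \<mu>"
      by (simp add: inner_vec_def \<mu>_def)
  qed
  show ?thesis by (rule exI[of _ \<mu>]) (use 1 2 3 in blast)
qed

section \<open>Projection onto the cone and the dual certificate\<close>

definition residual :: "(nat \<Rightarrow> nat \<Rightarrow> real) \<Rightarrow> ('K \<times> nat \<times> nat \<Rightarrow> real) \<Rightarrow> (nat \<times> nat \<Rightarrow> real) \<Rightarrow> nat \<Rightarrow> nat \<Rightarrow> real" where
  "residual B f w i j = Aop f i j - B i j - w (i, j)"

definition Wset :: "(nat \<times> nat \<Rightarrow> real) set" where
  "Wset = {w. (\<forall>i j. \<not> (i < n \<and> j < n) \<longrightarrow> w (i, j) = 0) \<and> psd_form n (\<lambda>i j. w (i, j))}"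

lemma zero_Lset:
  assumes "0 \<le> \<gamma>"
  shows "(\<lambda>_. 0) \<in> Lset \<gamma>"
proof -
  have "lam (\<lambda>_. 0) = 0" by (simp add: lam_def Finite_Cartesian_Product.vec_eq_iff)
  moreover have "phi T 0 \<le> 0" by (rule phi_le[OF T_compact T_ne]) simp
  ultimately show ?thesis using assms by (simp add: Lset_def psd_form_def bform_def)
qed

text \<open>The cone \<open>Wset\<close> is unbounded in general, so the search is restricted to
  pairs no worse than (0, 0). There the residual and \<open>Aop f\<close> are bounded, hence
  \<open>w\<close> is too.\<close>

lemma residual_attained:
  fixes B :: "nat \<Rightarrow> nat \<Rightarrow> real"
  assumes "0 \<le> \<gamma>"
  defines "F \<equiv> \<lambda>f w. \<Sum>i<n. \<Sum>j<n. (residual B f w i j)\<^sup>2"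
  shows "\<exists>f0\<in>Lset \<gamma>. \<exists>w0\<in>Wset. \<forall>f\<in>Lset \<gamma>. \<forall>w\<in>Wset. F f0 w0 \<le> F f w"
proof -
  define z where "z = F (\<lambda>_. 0) (\<lambda>_. 0)"
  have L0: "(\<lambda>_. 0) \<in> Lset \<gamma>" by (rule zero_Lset[OF assms(1)])
  have W0: "(\<lambda>_. 0) \<in> Wset" by (auto simp: Wset_def psd_form_def bform_def)
  have "continuous_on (Lset \<gamma>) (\<lambda>f. \<Sum>i<n. \<Sum>j<n. \<bar>Aop f i j\<bar>)"
    by (intro continuous_intros continuous_on_Aop)
  moreover have "Lset \<gamma> \<noteq> {}" using L0 by blast
  ultimately have "\<exists>f1\<in>Lset \<gamma>. \<forall>f\<in>Lset \<gamma>.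
      (\<Sum>i<n. \<Sum>j<n. \<bar>Aop f i j\<bar>) \<le> (\<Sum>i<n. \<Sum>j<n. \<bar>Aop f1 i j\<bar>)"
    using compact_Lset by (intro continuous_attains_sup)
  then obtain f1 where f1: "\<And>f. f \<in> Lset \<gamma> \<Longrightarrow>
      (\<Sum>i<n. \<Sum>j<n. \<bar>Aop f i j\<bar>) \<le> (\<Sum>i<n. \<Sum>j<n. \<bar>Aop f1 i j\<bar>)" by blast
  define M where "M = (\<Sum>i<n. \<Sum>j<n. \<bar>Aop f1 i j\<bar>)"
  have entry: "h i j \<le> (\<Sum>i<n. \<Sum>j<n. h i j)" if "i < n" "j < n" "\<And>i j. 0 \<le> h i j" for h :: "nat \<Rightarrow> nat \<Rightarrow> real" and i j
  proof -
    have "h i j \<le> (\<Sum>j<n. h i j)" using that by (intro member_le_sum) auto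
    also have "\<dots> \<le> (\<Sum>i<n. \<Sum>j<n. h i j)"
      using that by (intro member_le_sum[of i "{..<n}" "\<lambda>i. \<Sum>j<n. h i j"]) (auto intro: sum_nonneg)
    finally show ?thesis .
  qed
  \<comment> \<open>The triangle inequality for w = Aop f - B - residual, where
    \<open>sqrt z\<close> bounds each entry of the residual.\<close>
  define bd where "bd = (\<lambda>(i, j). M + \<bar>B i j\<bar> + sqrt z)"
  define Wb where "Wb = {w :: nat \<times> nat \<Rightarrow> real. \<forall>p. \<bar>w p\<bar> \<le> bd p}"
  define Z where "Z = {(f, w). f \<in> Lset \<gamma> \<and> w \<in> Wset \<and> F f w \<le> z}"
  have "compact Wb"
    unfolding Wb_def
    by (rule compact_bounded_coordinates[where M = bd]) (auto intro!: closed_Collect_all closed_Collect_le continuous_intros)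
  have sub: "Z \<subseteq> Lset \<gamma> \<times> Wb"
  proof clarify
    fix f w assume "(f, w) \<in> Z"
    then have f: "f \<in> Lset \<gamma>" and w: "w \<in> Wset" and le: "F f w \<le> z" by (auto simp: Z_def)
    have "0 \<le> M" by (auto simp: M_def intro!: sum_nonneg)
    moreover have "0 \<le> z" by (auto simp: z_def F_def intro!: sum_nonneg)
    ultimately have bd0: "0 \<le> bd p" for p by (cases p) (simp add: bd_def)
    have "\<bar>w (i, j)\<bar> \<le> bd (i, j)" if ij: "i < n" "j < n" for i j
    proof -
      have "(residual B f w i j)\<^sup>2 \<le> F f w" unfolding F_def by (rule entry[OF ij]) simp
      then have "\<bar>residual B f w i j\<bar> \<le> sqrt z" using le by (simp add: real_le_rsqrt)
      moreover have "\<bar>Aop f i j\<bar> \<le> M"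
        using entry[OF ij, of "\<lambda>i j. \<bar>Aop f i j\<bar>"] f1[OF f] by (simp add: M_def)
      ultimately show ?thesis by (simp add: residual_def bd_def)
    qed
    moreover have "\<bar>w (i, j)\<bar> \<le> bd (i, j)" if "\<not> (i < n \<and> j < n)" for i j
      using w that bd0[of "(i, j)"] by (auto simp: Wset_def)
    ultimately show "f \<in> Lset \<gamma> \<and> w \<in> Wb" using f by (auto simp: Wb_def)
  qed
  have cF: "continuous_on S (\<lambda>p. F (fst p) (snd p))" for S
    unfolding F_def residual_def by (intro continuous_intros continuous_on_Aop)
  have "closed Z"
  proof -
    have eq: "Z = (Lset \<gamma> \<times> UNIV) \<inter> {p. (\<forall>i j. \<not> (i < n \<and> j < n) \<longrightarrow> snd p (i, j) = 0)}
        \<inter> {p. psd_form n (\<lambda>i j. snd p (i, j))} \<inter> {p. F (fst p) (snd p) \<le> z}"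
      by (auto simp: Z_def Wset_def)
    show ?thesis unfolding eq
      by (intro closed_Int closed_Times compact_imp_closed[OF compact_Lset] closed_UNIV closed_Collect_all
          closed_Collect_imp open_Collect_const closed_Collect_eq closed_Collect_le closed_Collect_psd_form
          cF continuous_intros)
  qed
  then have "compact Z"
    using compact_Int_closed[OF compact_Times[OF compact_Lset \<open>compact Wb\<close>], of Z \<gamma>] sub
    by (simp add: Int_absorb1)
  moreover have Z0: "((\<lambda>_. 0), (\<lambda>_. 0)) \<in> Z" using L0 W0 by (simp add: Z_def z_def)
  then have "Z \<noteq> {}" by blast
  ultimately have "\<exists>p\<in>Z. \<forall>p'\<in>Z. F (fst p) (snd p) \<le> F (fst p') (snd p')"
    using cF by (intro continuous_attains_inf)
  then obtain p where p: "p \<in> Z" "\<And>p'. p' \<in> Z \<Longrightarrow> F (fst p) (snd p) \<le> F (fst p') (snd p')" by blast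
  obtain f0 w0 where fw: "p = (f0, w0)" by (cases p)
  have "F f0 w0 \<le> F f w" if "f \<in> Lset \<gamma>" "w \<in> Wset" for f w
  proof (cases "F f w \<le> z")
    case True
    then show ?thesis using p(2)[of "(f, w)"] that fw by (simp add: Z_def)
  next
    case False
    then show ?thesis using p(1) fw by (simp add: Z_def)
  qed
  then show ?thesis using p(1) fw by (auto simp: Z_def)
qed

text \<open>The vectors \<open>q\<^sub>j\<close> stand for the matrix \<open>Q = \<Sum>\<^sub>j q\<^sub>j q\<^sub>j\<^sup>T\<close>; \<open>Rsq k v\<close> is the Gram matrix of the vectors
  \<open>R\<^sup>k\<^sup>i v\<close>, so that the premise on q says \<open>R\<^sub>k[Q] \<preceq> t\<^sub>k I\<close>.\<close>

lemma dual_certificate: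
  fixes B :: "nat \<Rightarrow> nat \<Rightarrow> real"
  assumes B: "\<And>i j. i < n \<Longrightarrow> j < n \<Longrightarrow> B i j = B j i" and \<gamma>: "0 < \<gamma>"
    and primal: "\<And>q t. t \<in> T \<Longrightarrow>
      (\<And>k v. v \<in> carrier_vec (d k) \<Longrightarrow> (\<Sum>j<n. bform n (Rsq k v) (q j) (q j)) \<le> vec_nth t k * (v \<bullet> v)) \<Longrightarrow>
      (\<Sum>j<n. bform n B (q j) (q j)) \<le> \<gamma>"
  shows "\<exists>f\<in>Lset \<gamma>. psd_form n (\<lambda>i j. Aop f i j - B i j)"
proof -
  obtain f0 w0 where f0: "f0 \<in> Lset \<gamma>" and w0: "w0 \<in> Wset" and
    min: "\<And>f w. f \<in> Lset \<gamma> \<Longrightarrow> w \<in> Wset \<Longrightarrow>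
      (\<Sum>i<n. \<Sum>j<n. (residual B f0 w0 i j)\<^sup>2) \<le> (\<Sum>i<n. \<Sum>j<n. (residual B f w i j)\<^sup>2)"
    using residual_attained[OF less_imp_le[OF \<gamma>], of B] by blast
  define G where "G = residual B f0 w0"
  define ip where "ip H = (\<Sum>i<n. \<Sum>j<n. G i j * H i j)" for H :: "nat \<Rightarrow> nat \<Rightarrow> real"
  have ip_diff: "ip (\<lambda>i j. H i j - H' i j) = ip H - ip H'" for H H'
    by (simp add: ip_def algebra_simps sum_subtractf)
  have ip_uminus: "ip (\<lambda>i j. - H i j) = - ip H" for H
    by (simp add: ip_def sum_negf)
  have var: "0 \<le> ip H"
    if ex: "\<And>s. 0 < s \<Longrightarrow> s \<le> 1 \<Longrightarrow> \<exists>f\<in>Lset \<gamma>. \<exists>w\<in>Wset. \<forall>i<n. \<forall>j<n. residual B f w i j = G i j + s * H i j" for H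
    unfolding ip_def
  proof (rule sum_sq_variation_nonneg)
    fix s :: real assume "0 < s" "s \<le> 1"
    then obtain f w where "f \<in> Lset \<gamma>" "w \<in> Wset" "\<forall>i<n. \<forall>j<n. residual B f w i j = G i j + s * H i j"
      using ex by blast
    then show "(\<Sum>i<n. \<Sum>j<n. (G i j)\<^sup>2) \<le> (\<Sum>i<n. \<Sum>j<n. (G i j + s * H i j)\<^sup>2)"
      using min[of f w] by (simp add: G_def)
  qed
  have Wadd: "(\<lambda>p. w0 p + s * w p) \<in> Wset" if "w \<in> Wset" "0 \<le> s" for w s
    using w0 that by (auto simp: Wset_def intro!: psd_form_add psd_form_scale)
  have Wscale: "(\<lambda>p. s * w0 p) \<in> Wset" if "0 \<le> s" for s
    using w0 that by (auto simp: Wset_def intro!: psd_form_scale)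
  \<comment> \<open>Three kinds of directions are tested: towards another \<open>f\<close>, adding
    an element of the cone to \<open>w0\<close>, and shrinking \<open>w0\<close>. They give the
    variational inequality, the sign of \<open>- G\<close>, and one half of complementarity.\<close>
  have ipf: "ip (Aop f0) \<le> ip (Aop f)" if f: "f \<in> Lset \<gamma>" for f
  proof -
    have "0 \<le> ip (\<lambda>i j. Aop f i j - Aop f0 i j)"
    proof (rule var)
      fix s :: real assume s: "0 < s" "s \<le> 1"
      show "\<exists>f'\<in>Lset \<gamma>. \<exists>w\<in>Wset. \<forall>i<n. \<forall>j<n. residual B f' w i j = G i j + s * (Aop f i j - Aop f0 i j)"
        using Lset_convex[OF f0 f, of s] s w0
        by (intro bexI[of _ "\<lambda>p. f0 p + s * (f p - f0 p)"] bexI[of _ w0]) (auto simp: residual_def G_def Aop_affine)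
    qed
    then show ?thesis by (simp add: ip_diff)
  qed
  have ipw: "ip (\<lambda>i j. w (i, j)) \<le> 0" if w: "w \<in> Wset" for w
  proof -
    have "0 \<le> ip (\<lambda>i j. - w (i, j))"
    proof (rule var)
      fix s :: real assume s: "0 < s" "s \<le> 1"
      show "\<exists>f\<in>Lset \<gamma>. \<exists>w'\<in>Wset. \<forall>i<n. \<forall>j<n. residual B f w' i j = G i j + s * (- w (i, j))"
        using Wadd[OF w, of s] s f0
        by (intro bexI[of _ f0] bexI[of _ "\<lambda>p. w0 p + s * w p"]) (auto simp: residual_def G_def)
    qed
    then show ?thesis by (simp add: ip_uminus)
  qed
  have ipw0: "0 \<le> ip (\<lambda>i j. w0 (i, j))"
  proof (rule var)
    fix s :: real assume s: "0 < s" "s \<le> 1"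
    show "\<exists>f\<in>Lset \<gamma>. \<exists>w\<in>Wset. \<forall>i<n. \<forall>j<n. residual B f w i j = G i j + s * w0 (i, j)"
      using Wscale[of "1 - s"] s f0
      by (intro bexI[of _ f0] bexI[of _ "\<lambda>p. (1 - s) * w0 p"]) (auto simp: residual_def G_def algebra_simps)
  qed
  define N2 where "N2 = ip G"
  show ?thesis
  proof (cases "N2 = 0")
    case True
    have "\<forall>i<n. \<forall>j<n. G i j = 0"
    proof -
      have "\<forall>i\<in>{..<n}. (\<Sum>j<n. G i j * G i j) = 0"
        using True unfolding N2_def ip_def by (subst (asm) sum_nonneg_eq_0_iff) (auto intro: sum_nonneg)
      then show ?thesis by (auto simp: sum_nonneg_eq_0_iff)
    qed
    then have "psd_form n (\<lambda>i j. Aop f0 i j - B i j) \<longleftrightarrow> psd_form n (\<lambda>i j. w0 (i, j))"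
      by (intro psd_form_cong) (simp add: G_def residual_def)
    then show ?thesis using w0 f0 by (auto simp: Wset_def)
  next
    case False
    have "0 \<le> N2" by (auto simp: N2_def ip_def intro!: sum_nonneg)
    with False have N2: "0 < N2" by simp
    have G_sym: "G i j = G j i" if "i < n" "j < n" for i j
      using w0 that B[OF that] Aop_sym[OF that] by (simp add: G_def residual_def Wset_def psd_form_def)
    have "psd_form n (\<lambda>i j. - G i j)"
      unfolding psd_form_def
    proof (intro conjI allI impI)
      fix x :: "nat \<Rightarrow> real"
      \<comment> \<open>Rank-one elements of the cone suffice to test \<open>- G\<close>.\<close>
      define w where "w = (\<lambda>(i, j). if i < n \<and> j < n then x i * x j else 0)"
      have "psd_form n (\<lambda>i j. w (i, j)) \<longleftrightarrow> psd_form n (\<lambda>i j. x i * x j)"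
        by (rule psd_form_cong) (simp add: w_def)
      then have "w \<in> Wset" using psd_form_rank_one[of n x] by (auto simp: Wset_def w_def)
      then have "ip (\<lambda>i j. w (i, j)) \<le> 0" by (rule ipw)
      then show "0 \<le> bform n (\<lambda>i j. - G i j) x x"
        by (simp add: ip_def w_def bform_def sum_negf algebra_simps)
    qed (use G_sym in auto)
    then obtain q where gram: "\<And>a b. a < n \<Longrightarrow> b < n \<Longrightarrow> - G a b = (\<Sum>j<n. q j a * q j b)"
      using psd_form_gram by blast
    have q: "(\<Sum>j<n. bform n A (q j) (q j)) = - ip A" for A
    proof -
      have "(\<Sum>j<n. bform n A (q j) (q j)) = (\<Sum>a<n. \<Sum>b<n. A a b * - G a b)"
        by (rule sum_bform_gram) (rule gram)
      then show ?thesis by (simp add: ip_def sum_negf mult.commute)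
    qed
    define \<beta> where "\<beta> = (\<Sum>j<n. bform n B (q j) (q j))"
    \<comment> \<open>Here Q = - G separates: for every multiplier of value at most \<gamma>, Tr(Aop
      f Q) stays below Tr(B Q) by at least the squared norm \<open>N2\<close> of the
      residual.\<close>
    have f_le: "(\<Sum>j<n. bform n (Aop f) (q j) (q j)) \<le> \<beta> - N2" if f: "f \<in> Lset \<gamma>" for f
    proof -
      have "ip (Aop f0) = ip B + ip (\<lambda>i j. w0 (i, j)) + N2"
        unfolding N2_def ip_def sum.distrib[symmetric]
        by (intro sum.cong refl) (simp add: G_def residual_def algebra_simps)
      then show ?thesis using ipf[OF f] ipw0 unfolding q \<beta>_def by linarith
    qed
    obtain \<mu> :: "real ^ 'K" where mu0: "\<forall>k. 0 \<le> vec_nth \<mu> k"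
      and mu: "\<forall>k. \<forall>v\<in>carrier_vec (d k). (\<Sum>j<n. bform n (Rsq k v) (q j) (q j)) \<le> vec_nth \<mu> k * (v \<bullet> v)"
      and mug: "\<forall>g \<gamma>. (\<forall>k. 0 \<le> vec_nth g k) \<longrightarrow> phi T g \<le> \<gamma> \<longrightarrow>
        (\<exists>f\<in>Lset \<gamma>. (\<Sum>j<n. bform n (Aop f) (q j) (q j)) = inner g \<mu>)"
      using top_eigenvalues[of q] by blast
    \<comment> \<open>Half of the gap is kept: \<beta>' still bounds all multipliers, is positive
      because the zero multiplier forces \<beta> \<ge> N2, and lies strictly below \<beta>.\<close>
    define \<beta>' where "\<beta>' = \<beta> - N2 / 2"
    have "0 \<le> \<beta> - N2"
      using f_le[OF zero_Lset[of \<gamma>]] \<gamma> by (simp add: Aop_def bform_def)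
    with N2 have \<beta>': "0 < \<beta>'" "\<beta>' < \<beta>" by (simp_all add: \<beta>'_def)
    \<comment> \<open>With this scaling the polar condition puts c \<mu> into \<open>T\<close>, so c
      Q satisfies the premises of \<open>primal\<close>; but its trace against \<open>B\<close> is c
      \<beta>, which exceeds c \<beta>' = \<gamma>.\<close>
    define c where "c = \<gamma> / \<beta>'"
    have c: "0 < c" using \<gamma> \<beta>' by (simp add: c_def)
    have "c *\<^sub>R \<mu> \<in> T"
    proof (rule mem_monotonic_set_polar[OF T _ \<gamma>])
      show "0 \<le> vec_nth (c *\<^sub>R \<mu>) k" for k using mu0 c by simp
      fix g assume "\<And>k. 0 \<le> vec_nth g k" "phi T g \<le> \<gamma>"
      with mug obtain f where "f \<in> Lset \<gamma>" "(\<Sum>j<n. bform n (Aop f) (q j) (q j)) = inner g \<mu>" by blast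
      with f_le[of f] N2 have "inner g \<mu> \<le> \<beta>'" by (simp add: \<beta>'_def)
      then have "c * inner g \<mu> \<le> c * \<beta>'" using c by (intro mult_left_mono) auto
      also have "\<dots> = \<gamma>" using \<beta>' by (simp add: c_def)
      finally show "inner g (c *\<^sub>R \<mu>) \<le> \<gamma>" by simp
    qed
    moreover define p where "p j a = sqrt c * q j a" for j a
    have bp: "(\<Sum>j<n. bform n A (p j) (p j)) = c * (\<Sum>j<n. bform n A (q j) (q j))" for A
    proof -
      have "bform n A (p j) (p j) = c * bform n A (q j) (q j)" for j
      proof -
        have "bform n A (p j) (p j) = sqrt c * (sqrt c * bform n A (q j) (q j))"
          unfolding p_def by (simp only: bform_cmult_left bform_cmult_right)
        then show ?thesis using c by (simp add: mult.assoc[symmetric])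
      qed
      then show ?thesis by (simp add: sum_distrib_left)
    qed
    have "(\<Sum>j<n. bform n (Rsq k v) (p j) (p j)) \<le> vec_nth (c *\<^sub>R \<mu>) k * (v \<bullet> v)" if "v \<in> carrier_vec (d k)" for k v
      unfolding bp using mult_left_mono[OF mu[rule_format, OF that], of c] c by (simp add: mult.assoc)
    ultimately have "(\<Sum>j<n. bform n B (p j) (p j)) \<le> \<gamma>" by (intro primal)
    then have "c * \<beta> \<le> \<gamma>" by (simp add: bp \<beta>_def)
    moreover have "c * \<beta>' < c * \<beta>" using c \<beta>' by simp
    moreover have "c * \<beta>' = \<gamma>" using \<beta>' by (simp add: c_def)
    ultimately show ?thesis by simp
  qed
qed

end

section \<open>Compactness of the primal set, rounding and attainment\<close>

lemma bform_sum_left: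
  fixes q :: "nat \<Rightarrow> nat \<Rightarrow> real"
  shows "bform n Q (\<lambda>a. \<Sum>j<N. e j * q j a) z = (\<Sum>j<N. e j * bform n Q (q j) z)"
  by (induction N) (simp_all add: bform_linear, simp add: bform_def)

lemma bform_sum_right:
  fixes q :: "nat \<Rightarrow> nat \<Rightarrow> real"
  shows "bform n Q z (\<lambda>a. \<Sum>j<N. e j * q j a) = (\<Sum>j<N. e j * bform n Q z (q j))"
  by (induction N) (simp_all add: bform_linear, simp add: bform_def)

context spectratope_data
begin

text \<open>The spectratope before \<open>P\<close> is applied, with \<open>t\<close> retained:
  every condition is then closed and no existential quantifier over \<open>t\<close>
  remains.\<close>

definition Yset :: "((nat \<Rightarrow> real) \<times> (real ^ 'K)) set" where
  "Yset = {(x, t). (\<forall>i. i \<notin> {..<n} \<longrightarrow> x i = 0) \<and> t \<in> T \<and>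
     (\<forall>k v. v \<in> carrier_vec (d k) \<longrightarrow> bform n (Rsq k v) x x \<le> vec_nth t k * (v \<bullet> v))}"

lemma Rm_index: "a < d k \<Longrightarrow> b < d k \<Longrightarrow> Rm k x $$ (a, b) = (\<Sum>i<n. x i * R k i $$ (a, b))"
  by (simp add: Rm_def)

lemma frobenius_sq_Rm: "frobenius_sq (Rm k x) = (\<Sum>a<d k. \<Sum>b<d k. (\<Sum>i<n. x i * R k i $$ (a, b))\<^sup>2)"
  unfolding frobenius_sq_def using carrier_matD[OF Rm_carrier[of k x]] by (simp add: Rm_index)

text \<open>Both sides are homogeneous of degree 2, so the minimum of the right-hand side on the
  unit sphere serves as the constant; nondegeneracy makes it positive.\<close>

lemma coercive:
  assumes inj: "\<And>x. (\<And>k. Rm k x = 0\<^sub>m (d k) (d k)) \<Longrightarrow> (\<Sum>i<n. (x i)\<^sup>2) = 0"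
  shows "\<exists>c>0. \<forall>x. c * (\<Sum>i<n. (x i)\<^sup>2) \<le> (\<Sum>k\<in>UNIV. frobenius_sq (Rm k x))"
proof -
  define F where "F x = (\<Sum>k\<in>UNIV. frobenius_sq (Rm k x))" for x
  define Z where "Z = {x :: nat \<Rightarrow> real. (\<forall>i. i \<notin> {..<n} \<longrightarrow> x i = 0) \<and> (\<Sum>i<n. (x i)\<^sup>2) = 1}"
  have F0: "0 \<le> F x" for x by (auto simp: F_def intro!: sum_nonneg frobenius_sq_nonneg)
  have Fscale: "F (\<lambda>i. if i < n then s * x i else 0) = s\<^sup>2 * F x" for s x
    by (simp add: F_def frobenius_sq_Rm sum_distrib_left[symmetric] mult.assoc power_mult_distrib)
  have "compact Z"
  proof (rule compact_bounded_coordinates)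
    show "closed Z" unfolding Z_def
      by (intro closed_Collect_conj closed_Collect_all closed_Collect_imp open_Collect_const
          closed_Collect_eq closed_Collect_le continuous_intros)
    fix x i assume x: "x \<in> Z"
    show "\<bar>x i\<bar> \<le> 1"
    proof (cases "i < n")
      case True
      then have "(x i)\<^sup>2 \<le> (\<Sum>i<n. (x i)\<^sup>2)" by (intro member_le_sum) auto
      then show ?thesis using x by (simp add: Z_def abs_square_le_1)
    qed (use x in \<open>auto simp: Z_def\<close>)
  qed
  have norm: "(\<lambda>i. if i < n then (1 / sqrt s) * x i else 0) \<in> Z"
    if "0 < s" "s = (\<Sum>i<n. (x i)\<^sup>2)" for x s
  proof -
    have "(\<Sum>i<n. ((1 / sqrt s) * x i)\<^sup>2) = (\<Sum>i<n. (x i)\<^sup>2) / s"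
      using that(1) by (simp add: power_divide sum_divide_distrib)
    then show ?thesis using that by (simp add: Z_def)
  qed
  have pos: "0 < (\<Sum>i<n. (x i)\<^sup>2) \<or> (\<Sum>i<n. (x i)\<^sup>2) = 0" for x :: "nat \<Rightarrow> real"
    using sum_nonneg[of "{..<n}" "\<lambda>i. (x i)\<^sup>2"] by (simp add: order_less_le)
  show ?thesis
  \<comment> \<open>The sphere is empty only for \<open>n = 0\<close>, where any constant
    works.\<close>
  proof (cases "Z = {}")
    case True
    then have "(\<Sum>i<n. (x i)\<^sup>2) = 0" for x :: "nat \<Rightarrow> real" using norm[of _ x] pos[of x] by blast
    then show ?thesis using F0 by (intro exI[of _ 1]) (simp add: F_def)
  next
    case False
    have "continuous_on Z F" unfolding F_def frobenius_sq_Rm by (intro continuous_intros)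
    with \<open>compact Z\<close> False have "\<exists>x\<in>Z. \<forall>y\<in>Z. F x \<le> F y" by (rule continuous_attains_inf)
    then obtain x where x: "x \<in> Z" "\<And>y. y \<in> Z \<Longrightarrow> F x \<le> F y" by blast
    have "F x \<noteq> 0"
    proof
      assume "F x = 0"
      then have "frobenius_sq (Rm k x) = 0" for k
        unfolding F_def using frobenius_sq_nonneg by (subst (asm) sum_nonneg_eq_0_iff) auto
      then have "Rm k x = 0\<^sub>m (d k) (d k)" for k
        using carrier_matD[OF Rm_carrier[of k x]]
        by (intro eq_matI) (auto simp: frobenius_sq_def sum_nonneg_eq_0_iff sum_nonneg)
      then have "(\<Sum>i<n. (x i)\<^sup>2) = 0" by (rule inj)
      then show False using x(1) by (simp add: Z_def)
    qed
    then have c: "0 < F x" using F0[of x] by simp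
    have "F x * (\<Sum>i<n. (y i)\<^sup>2) \<le> F y" for y
    proof (cases "(\<Sum>i<n. (y i)\<^sup>2) = 0")
      case False
      define s where "s = (\<Sum>i<n. (y i)\<^sup>2)"
      have s: "0 < s" using pos[of y] False by (simp add: s_def)
      have "F x \<le> (1 / sqrt s)\<^sup>2 * F y" unfolding Fscale[symmetric] by (rule x(2)[OF norm[OF s s_def]])
      then show ?thesis using s unfolding s_def[symmetric] by (simp add: power_divide field_simps)
    qed (use F0 in simp)
    then show ?thesis using c by (auto simp: F_def)
  qed
qed

text \<open>The trace of the constraint bounds the squared Frobenius norm of R_k[x] by t_k d_k;
  boundedness of \<open>T\<close> and coercivity then bound \<open>x\<close>.\<close>

lemma compact_Yset:
  assumes inj: "\<And>x. (\<And>k. Rm k x = 0\<^sub>m (d k) (d k)) \<Longrightarrow> (\<Sum>i<n. (x i)\<^sup>2) = 0"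
  shows "compact Yset"
proof -
  obtain c where c: "0 < c" "\<And>x. c * (\<Sum>i<n. (x i)\<^sup>2) \<le> (\<Sum>k\<in>UNIV. frobenius_sq (Rm k x))"
    using coercive[OF inj] by blast
  obtain M where M: "\<And>t. t \<in> T \<Longrightarrow> norm t \<le> M"
    using compact_imp_bounded[OF T_compact] by (auto simp: bounded_iff)
  define b where "b = sqrt ((\<Sum>k\<in>UNIV. M * d k) / c)"
  have bound: "\<bar>x i\<bar> \<le> b" if xt: "(x, t) \<in> Yset" for x t i
  proof -
    have t: "t \<in> T" using xt by (simp add: Yset_def)
    have "0 \<le> M" using M[OF t] norm_ge_zero[of t] by linarith
    then have b0: "0 \<le> b" using c by (auto simp: b_def intro!: sum_nonneg divide_nonneg_pos)
    have "frobenius_sq (Rm k x) \<le> M * d k" for k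
    proof -
      have "psd_form (d k) (\<lambda>a b. 1\<^sub>m (d k) $$ (a, b))"
        unfolding psd_form_def bform_def
        by (auto simp: if_distrib[of "\<lambda>z. z * _"] if_distrib[of "\<lambda>z. _ * z"] intro!: sum_nonneg cong: if_cong)
      then have "mat_trace (1\<^sub>m (d k) * (Rm k x * Rm k x)) \<le> vec_nth t k * mat_trace (1\<^sub>m (d k))"
        using xt by (intro psd_form_mat_trace_mult_le[of "d k"]) (auto simp: Rm_sym Rm_sq Yset_def)
      moreover have "mat_trace (1\<^sub>m (d k)) = d k" by (simp add: mat_trace_def)
      moreover have "1\<^sub>m (d k) * (Rm k x * Rm k x) = Rm k x * Rm k x"
        using Rm_carrier by (intro left_mult_one_mat) (auto intro: mult_carrier_mat)
      moreover have "mat_trace (Rm k x * Rm k x) = frobenius_sq (Rm k x)"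
        by (metis mat_trace_transpose_self sym_matsD(2)[OF Rm_sym])
      ultimately have "frobenius_sq (Rm k x) \<le> vec_nth t k * d k" by simp
      also have "\<dots> \<le> M * d k"
        using M[OF t] component_le_norm_cart[of t k] by (intro mult_right_mono) auto
      finally show ?thesis .
    qed
    then have "(\<Sum>k\<in>UNIV. frobenius_sq (Rm k x)) \<le> (\<Sum>k\<in>UNIV. M * d k)" by (intro sum_mono)
    with c(2)[of x] have "c * (\<Sum>i<n. (x i)\<^sup>2) \<le> (\<Sum>k\<in>UNIV. M * d k)" by linarith
    then have s: "(\<Sum>i<n. (x i)\<^sup>2) \<le> (\<Sum>k\<in>UNIV. M * d k) / c" using c(1) by (simp add: field_simps)
    show ?thesis
    proof (cases "i < n")
      case True
      then have "(x i)\<^sup>2 \<le> (\<Sum>i<n. (x i)\<^sup>2)" by (intro member_le_sum) auto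
      then show ?thesis using s unfolding b_def by (intro real_le_rsqrt) simp
    next
      case False
      then show ?thesis using xt b0 by (simp add: Yset_def)
    qed
  qed
  have "compact {x :: nat \<Rightarrow> real. \<forall>i. \<bar>x i\<bar> \<le> b}"
    by (rule compact_bounded_coordinates[where M = "\<lambda>_. b"])
       (auto intro!: closed_Collect_all closed_Collect_le continuous_intros)
  then have "compact ({x :: nat \<Rightarrow> real. \<forall>i. \<bar>x i\<bar> \<le> b} \<times> T)" by (rule compact_Times[OF _ T_compact])
  moreover have "closed Yset"
  proof -
    have eq: "Yset = (UNIV \<times> T) \<inter> {p. (\<forall>i. i \<notin> {..<n} \<longrightarrow> fst p i = 0) \<and>
        (\<forall>k v. v \<in> carrier_vec (d k) \<longrightarrow> bform n (Rsq k v) (fst p) (fst p) \<le> vec_nth (snd p) k * (v \<bullet> v))}"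
      by (auto simp: Yset_def)
    show ?thesis unfolding eq bform_def
      by (intro closed_Int closed_Times closed_UNIV compact_imp_closed[OF T_compact] closed_Collect_conj
          closed_Collect_all closed_Collect_imp open_Collect_const closed_Collect_eq closed_Collect_le continuous_intros)
  qed
  moreover have "Yset \<subseteq> {x. \<forall>i. \<bar>x i\<bar> \<le> b} \<times> T" using bound by (auto simp: Yset_def)
  ultimately show ?thesis by (metis compact_Int_closed inf.absorb_iff2)
qed

lemma zero_Yset: "(\<lambda>_. 0, 0) \<in> Yset"
  using monotonic_setD(7)[OF T] by (simp add: Yset_def bform_def)

lemma weak_duality:
  assumes f: "\<And>k. psd_form (d k) (\<lambda>a b. f (k, a, b))" and fB: "psd_form n (\<lambda>i j. Aop f i j - B i j)"
    and xt: "(x, t) \<in> Yset"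
  shows "bform n B x x \<le> phi T (lam f)"
proof -
  have t: "t \<in> T" using xt by (simp add: Yset_def)
  have "bform n (\<lambda>i j. Aop f i j - B i j) x x = bform n (Aop f) x x - bform n B x x"
    by (simp add: bform_def algebra_simps sum_subtractf)
  moreover have "0 \<le> bform n (\<lambda>i j. Aop f i j - B i j) x x" using fB unfolding psd_form_def by blast
  ultimately have "bform n B x x \<le> bform n (Aop f) x x" by linarith
  also have "\<dots> = (\<Sum>k\<in>UNIV. mat_trace (mat_of f k * (Rm k x * Rm k x)))" by (rule bform_Aop)
  also have "\<dots> \<le> (\<Sum>k\<in>UNIV. vec_nth t k * mat_trace (mat_of f k))"
  proof (rule sum_mono)
    fix k :: 'K
    have "psd_form (d k) (\<lambda>a b. mat_of f k $$ (a, b)) \<longleftrightarrow> psd_form (d k) (\<lambda>a b. f (k, a, b))"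
      by (rule psd_form_cong) (simp add: mat_of_def)
    then show "mat_trace (mat_of f k * (Rm k x * Rm k x)) \<le> vec_nth t k * mat_trace (mat_of f k)"
      using xt f[of k] by (intro psd_form_mat_trace_mult_le[of "d k"]) (auto simp: Rm_sym Rm_sq Yset_def)
  qed
  also have "\<dots> = inner (lam f) t" by (simp add: lam_eq lambda_vec_def inner_vec_def mult.commute)
  also have "\<dots> \<le> phi T (lam f)" by (rule phi_ge[OF T_compact t])
  finally show ?thesis .
qed

text \<open>Hypotheses and value depend on \<open>q\<close> only through its Gram matrix, so
  \<open>q\<close> may be taken orthogonal for \<open>B\<close>. Cross terms then vanish and every
  sign vector gives the same value, which leaves the signs free to serve the constraints. Division
  by sqrt r restores feasibility with the same \<open>t\<close>.\<close>

lemma rounding: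
  fixes B :: "nat \<Rightarrow> nat \<Rightarrow> real"
  assumes B: "\<And>i j. i < n \<Longrightarrow> j < n \<Longrightarrow> B i j = B j i" and t: "t \<in> T"
    and q: "\<And>k v. v \<in> carrier_vec (d k) \<Longrightarrow> (\<Sum>j<n. bform n (Rsq k v) (q j) (q j)) \<le> vec_nth t k * (v \<bullet> v)"
  defines "r \<equiv> 2 * max (ln (2 * real (\<Sum>k\<in>UNIV. d k))) 1"
  shows "\<exists>x. (x, t) \<in> Yset \<and> (\<Sum>j<n. bform n B (q j) (q j)) = r * bform n B x x"
proof -
  have r: "0 < r" by (simp add: r_def)
  have "\<exists>q'. (\<forall>a<n. \<forall>b<n. (\<Sum>j<n. q' j a * q' j b) = (\<Sum>j<n. q j a * q j b)) \<and>
    (\<forall>i<n. \<forall>j<n. i \<noteq> j \<longrightarrow> bform n B (q' i) (q' j) = 0)"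
    by (rule gram_diagonalize) (rule B)
  then obtain q' where gram: "\<forall>a<n. \<forall>b<n. (\<Sum>j<n. q' j a * q' j b) = (\<Sum>j<n. q j a * q j b)"
    and orth: "\<forall>i<n. \<forall>j<n. i \<noteq> j \<longrightarrow> bform n B (q' i) (q' j) = 0" by blast
  have same: "(\<Sum>j<n. bform n A (q j) (q j)) = (\<Sum>j<n. bform n A (q' j) (q' j))" for A
  proof -
    have "(\<Sum>j<n. bform n A (q j) (q j)) = (\<Sum>a<n. \<Sum>b<n. A a b * (\<Sum>j<n. q j a * q j b))"
      by (rule sum_bform_gram) simp
    also have "\<dots> = (\<Sum>j<n. bform n A (q' j) (q' j))"
      by (rule sum_bform_gram[symmetric]) (use gram in simp)
    finally show ?thesis .
  qed
  obtain e where e: "e \<in> signs n" and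
    le: "\<And>k v. v \<in> carrier_vec (d k) \<Longrightarrow>
      (R_map (d k) n (\<lambda>j. Rm k (q' j)) (Matrix.vec n e) *\<^sub>v v) \<bullet> (R_map (d k) n (\<lambda>j. Rm k (q' j)) (Matrix.vec n e) *\<^sub>v v)
        \<le> r * vec_nth t k * (v \<bullet> v)"
    using random_signs_rounding[of n "\<lambda>k j. Rm k (q' j)" d "vec_nth t"] q
    unfolding r_def by (auto simp: Rm_sym Rm_sq same T_nonneg[OF t])
  define y where "y a = (\<Sum>j<n. e j * q' j a)" for a
  have "R_map (d k) n (\<lambda>j. Rm k (q' j)) (Matrix.vec n e) = Rm k y" for k
    unfolding Rm_def y_def by (rule R_map_R_map)
  then have le': "bform n (Rsq k v) y y \<le> r * vec_nth t k * (v \<bullet> v)" if "v \<in> carrier_vec (d k)" for k v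
    using le[OF that] by (simp add: Rm_sq that)
  define x where "x i = (if i < n then (1 / sqrt r) * y i else 0)" for i
  have bx: "bform n A x x = bform n A y y / r" for A
  proof -
    have "bform n A x x = bform n A (\<lambda>i. (1 / sqrt r) * y i) (\<lambda>i. (1 / sqrt r) * y i)"
      by (simp add: bform_def x_def)
    also have "\<dots> = (1 / sqrt r) * ((1 / sqrt r) * bform n A y y)" by (simp only: bform_cmult_left bform_cmult_right)
    also have "\<dots> = bform n A y y / r" using r by simp
    finally show ?thesis .
  qed
  have "(x, t) \<in> Yset"
    using t le' r by (auto simp: Yset_def bx x_def divide_le_eq mult.assoc mult.left_commute mult.commute)
  moreover have "bform n B y y = (\<Sum>j<n. bform n B (q' j) (q' j))"
  proof -
    have "bform n B y y = (\<Sum>i<n. e i * (\<Sum>j<n. e j * bform n B (q' i) (q' j)))"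
      unfolding y_def by (simp only: bform_sum_left bform_sum_right)
    also have "\<dots> = (\<Sum>i<n. e i * (e i * bform n B (q' i) (q' i)))"
    proof (intro sum.cong refl arg_cong[of _ _ "(*) _"])
      fix i assume i: "i \<in> {..<n}"
      have "(\<Sum>j<n. e j * bform n B (q' i) (q' j)) = (\<Sum>j<n. if j = i then e i * bform n B (q' i) (q' i) else 0)"
        using i orth by (intro sum.cong) auto
      then show "(\<Sum>j<n. e j * bform n B (q' i) (q' j)) = e i * bform n B (q' i) (q' i)" using i by simp
    qed
    also have "\<dots> = (\<Sum>i<n. bform n B (q' i) (q' i))"
      using e by (intro sum.cong refl) (force simp: signs_def PiE_iff)
    finally show ?thesis .
  qed
  ultimately show ?thesis using r by (intro exI[of _ x]) (simp add: bx same)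
qed

text \<open>\<open>dual_certificate\<close> asks for a positive level and \<open>opt\<close> may be
  0, so levels strictly above r opt come first. A minimiser over one compact set of this kind lies
  below all such levels, hence has value at most r opt.\<close>

lemma relaxation_bound:
  fixes B :: "nat \<Rightarrow> nat \<Rightarrow> real"
  assumes B: "\<And>i j. i < n \<Longrightarrow> j < n \<Longrightarrow> B i j = B j i"
    and opt: "\<And>x t. (x, t) \<in> Yset \<Longrightarrow> bform n B x x \<le> opt"
  defines "r \<equiv> 2 * max (ln (2 * real (\<Sum>k\<in>UNIV. d k))) 1"
  shows "\<exists>f\<in>Lset (r * opt). psd_form n (\<lambda>i j. Aop f i j - B i j) \<and>
    (\<forall>\<gamma>. \<forall>g\<in>Lset \<gamma>. psd_form n (\<lambda>i j. Aop g i j - B i j) \<longrightarrow> phi T (lam f) \<le> phi T (lam g))"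
proof -
  have r: "0 < r" by (simp add: r_def)
  have opt0: "0 \<le> opt" using opt[OF zero_Yset] by (simp add: bform_def)
  define S where "S \<gamma> = Lset \<gamma> \<inter> {f. psd_form n (\<lambda>i j. Aop f i j - B i j)}" for \<gamma>
  have ne: "S \<gamma> \<noteq> {}" if \<gamma>: "r * opt < \<gamma>" for \<gamma>
  proof -
    have "0 \<le> r * opt" using opt0 r by simp
    with \<gamma> have \<gamma>0: "0 < \<gamma>" by linarith
    have "\<exists>f\<in>Lset \<gamma>. psd_form n (\<lambda>i j. Aop f i j - B i j)"
    proof (rule dual_certificate)
      show "B i j = B j i" if "i < n" "j < n" for i j using that by (rule B)
      show "0 < \<gamma>" by (rule \<gamma>0)
      fix q t
      assume t: "t \<in> T" and q: "\<And>k v. v \<in> carrier_vec (d k) \<Longrightarrow>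
        (\<Sum>j<n. bform n (Rsq k v) (q j) (q j)) \<le> vec_nth t k * (v \<bullet> v)"
      have "\<exists>x. (x, t) \<in> Yset \<and> (\<Sum>j<n. bform n B (q j) (q j)) = r * bform n B x x"
        unfolding r_def by (rule rounding) (use B t q in auto)
      then obtain x where x: "(x, t) \<in> Yset" "(\<Sum>j<n. bform n B (q j) (q j)) = r * bform n B x x" by blast
      have "r * bform n B x x \<le> r * opt" using opt[OF x(1)] r by simp
      then show "(\<Sum>j<n. bform n B (q j) (q j)) \<le> \<gamma>" using x(2) \<gamma> by simp
    qed
    then show ?thesis by (auto simp: S_def)
  qed
  have "closed {f. psd_form n (\<lambda>i j. Aop f i j - B i j)}"
    by (rule closed_Collect_psd_form) (intro continuous_intros continuous_on_Aop continuous_on_id)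
  \<comment> \<open>Any positive excess over r opt would serve as the cut-off; multipliers beyond it
    are worse than the minimiser anyway.\<close>
  then have "compact (S (r * opt + 1))" unfolding S_def by (rule compact_Int_closed[OF compact_Lset])
  moreover have "S (r * opt + 1) \<noteq> {}" by (rule ne) simp
  moreover have "continuous_on (S (r * opt + 1)) (\<lambda>f. phi T (lam f))"
    by (rule continuous_on_subset[OF continuous_on_phi_lam]) simp
  ultimately have "\<exists>f\<in>S (r * opt + 1). \<forall>g\<in>S (r * opt + 1). phi T (lam f) \<le> phi T (lam g)"
    by (rule continuous_attains_inf)
  then obtain f where f: "f \<in> S (r * opt + 1)" "\<And>g. g \<in> S (r * opt + 1) \<Longrightarrow> phi T (lam f) \<le> phi T (lam g)" by blast
  have min: "phi T (lam f) \<le> phi T (lam g)" if g: "g \<in> Lset \<gamma>" "psd_form n (\<lambda>i j. Aop g i j - B i j)" for g \<gamma>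
  proof (cases "phi T (lam g) \<le> r * opt + 1")
    case True
    then show ?thesis using g f(2)[of g] by (simp add: S_def Lset_def)
  next
    case False
    then show ?thesis using f(1) by (simp add: S_def Lset_def)
  qed
  have "phi T (lam f) \<le> r * opt"
  proof (rule field_le_epsilon)
    fix \<epsilon> :: real assume "0 < \<epsilon>"
    then obtain g where "g \<in> S (r * opt + \<epsilon>)" using ne[of "r * opt + \<epsilon>"] by auto
    then show "phi T (lam f) \<le> r * opt + \<epsilon>" using min[of g] by (force simp: S_def Lset_def)
  qed
  then have "f \<in> Lset (r * opt)" using f(1) by (simp add: S_def Lset_def)
  then show ?thesis using f(1) min by (auto simp: S_def)
qed

end

theorem proposition2p1:
  fixes p n :: nat
    and d :: "'K::finite \<Rightarrow> nat"
    and C P :: "real Matrix.mat"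
    and R :: "'K \<Rightarrow> nat \<Rightarrow> real Matrix.mat"
    and T :: "(real ^ 'K) set"
  assumes "C \<in> sym_mats p"
    and "P \<in> carrier_mat p n"
    and "\<And>k i. i < n \<Longrightarrow> R k i \<in> sym_mats (d k)"
    and "monotonic_set T"
    and "\<And>y. y \<in> carrier_vec n \<Longrightarrow> y \<noteq> 0\<^sub>v n \<Longrightarrow> \<exists>k. R_map (d k) n (R k) y \<noteq> 0\<^sub>m (d k) (d k)"
  defines "X \<equiv> spectratope n d P R T"
    and "D \<equiv> (\<Sum>k\<in>UNIV. d k)"
  shows "(\<exists>x. is_arg_max (quad C) (\<lambda>x. x \<in> X) x)
    \<and> (\<exists>L. is_arg_min (\<lambda>L. phi T (lambda_vec L)) (\<lambda>L. L \<in> feasible n d C P R) L)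
    \<and> Opt C X \<le> Opt_star n d C P R T
    \<and> Opt_star n d C P R T \<le> 2 * max (ln (2 * real D)) 1 * Opt C X"
proof -
  \<comment> \<open>The locale works in the variable y alone; \<open>P\<close> and \<open>C\<close>
    enter through the form \<open>B\<close> of P^T C P.\<close>
  interpret spectratope_data n d R T
    using assms(3,4) by unfold_locales
  define M where "M = transpose_mat P * C * P"
  define B where "B i j = M $$ (i, j)" for i j
  note Cc = sym_matsD(1)[OF assms(1)] and Pc = assms(2)
  have Mc: "M \<in> carrier_mat n n" using Cc Pc by (simp add: M_def)
  have "transpose_mat M = M"
    using Cc Pc sym_matsD(2)[OF assms(1)]
    by (simp add: M_def transpose_mult[of _ n p _ n] transpose_mult[of _ n p _ p] transpose_mult[of _ p p _ n]
        assoc_mult_mat[of _ n p _ p _ n] mult_carrier_mat[of _ n p _ p])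
  then have Ms: "M \<in> sym_mats n" using Mc by (simp add: sym_mats_def)
  have B: "B i j = B j i" if "i < n" "j < n" for i j using sym_matsD(3)[OF Ms that] by (simp add: B_def)
  have quadC: "quad C (P *\<^sub>v Matrix.vec n x) = bform n B x x" for x
  proof -
    let ?x = "Matrix.vec n x"
    have "bform n B x x = quad M ?x" using quad_eq_bform[OF Mc, of x] by (simp add: B_def[abs_def])
    also have "M *\<^sub>v ?x = transpose_mat P *\<^sub>v (C *\<^sub>v (P *\<^sub>v ?x))"
      using Cc Pc by (simp add: M_def assoc_mult_mat_vec[of _ n p _ n] assoc_mult_mat_vec[of _ n p _ p] mult_carrier_mat[of _ n p _ p])
    then have "quad M ?x = ?x \<bullet> (transpose_mat P *\<^sub>v (C *\<^sub>v (P *\<^sub>v ?x)))" by (simp add: quad_def)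
    also have "\<dots> = (transpose_mat P *\<^sub>v (C *\<^sub>v (P *\<^sub>v ?x))) \<bullet> ?x"
      using Cc Pc by (intro comm_scalar_prod[of _ n]) auto
    also have "\<dots> = (C *\<^sub>v (P *\<^sub>v ?x)) \<bullet> (P *\<^sub>v ?x)"
      using Cc Pc by (intro transpose_vec_mult_scalar[of _ p n]) auto
    also have "\<dots> = quad C (P *\<^sub>v ?x)"
      unfolding quad_def using Cc Pc by (intro comm_scalar_prod[of _ p]) auto
    finally show ?thesis by simp
  qed
  \<comment> \<open>\<open>X\<close> is the image of \<open>Yset\<close> under \<open>P\<close>;
    with \<open>quadC\<close> the maximisation moves to a compact set.\<close>
  have X_iff: "x \<in> X \<longleftrightarrow> (\<exists>y t. (y, t) \<in> Yset \<and> x = P *\<^sub>v Matrix.vec n y)" for x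
  proof
    assume "x \<in> X"
    then obtain y t where y: "y \<in> carrier_vec n" "t \<in> T" "x = P *\<^sub>v y"
      and le: "\<And>k. loewner_le (R_map (d k) n (R k) y * R_map (d k) n (R k) y) (vec_nth t k \<cdot>\<^sub>m 1\<^sub>m (d k))"
      unfolding X_def spectratope_def by blast
    define y' where "y' i = (if i < n then y $ i else 0)" for i
    have yy: "Matrix.vec n y' = y" using y(1) by (intro eq_vecI) (auto simp: y'_def)
    then have "Rm k y' = R_map (d k) n (R k) y" for k by (simp add: Rm_def)
    then have "(y', t) \<in> Yset"
      using le loewner_le_square_iff[OF Rm_sym[of _ y']] y(2) by (auto simp: Yset_def y'_def Rm_sq[symmetric])
    then show "\<exists>y t. (y, t) \<in> Yset \<and> x = P *\<^sub>v Matrix.vec n y" using yy y(3) by blast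
  next
    assume "\<exists>y t. (y, t) \<in> Yset \<and> x = P *\<^sub>v Matrix.vec n y"
    then obtain y t where yt: "(y, t) \<in> Yset" "x = P *\<^sub>v Matrix.vec n y" by blast
    have "loewner_le (Rm k y * Rm k y) (vec_nth t k \<cdot>\<^sub>m 1\<^sub>m (d k))" for k
      unfolding loewner_le_square_iff[OF Rm_sym] using yt(1) by (auto simp: Yset_def Rm_sq)
    then show "x \<in> X"
      unfolding X_def spectratope_def using yt
      by (auto simp: Rm_def Yset_def intro!: bexI[of _ "Matrix.vec n y"] bexI[of _ t])
  qed
  have "compact Yset"
  proof (rule compact_Yset)
    fix x assume x: "\<And>k. Rm k x = 0\<^sub>m (d k) (d k)"
    then have "Matrix.vec n x = 0\<^sub>v n" using assms(5)[of "Matrix.vec n x"] by (auto simp: Rm_def)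
    then have "x i = 0" if "i < n" for i using that by (metis index_vec index_zero_vec(1))
    then show "(\<Sum>i<n. (x i)\<^sup>2) = 0" by simp
  qed
  moreover have "Yset \<noteq> {}" using zero_Yset by blast
  moreover have "continuous_on Yset (\<lambda>p. bform n B (fst p) (fst p))"
    unfolding bform_def by (intro continuous_intros)
  ultimately have "\<exists>p\<in>Yset. \<forall>p'\<in>Yset. bform n B (fst p') (fst p') \<le> bform n B (fst p) (fst p)"
    by (rule continuous_attains_sup)
  then obtain y0 t0 where y0: "(y0, t0) \<in> Yset"
    and max: "\<And>y t. (y, t) \<in> Yset \<Longrightarrow> bform n B y y \<le> bform n B y0 y0" by fastforce
  define x0 where "x0 = P *\<^sub>v Matrix.vec n y0"
  have x0: "x0 \<in> X" using y0 by (auto simp: X_iff x0_def)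
  have xmax: "quad C x \<le> quad C x0" if "x \<in> X" for x
    using that max by (auto simp: X_iff x0_def quadC)
  have "Opt C X = quad C x0"
    unfolding Opt_def using x0 xmax by (intro cSup_eq_maximum) auto
  then have opt: "Opt C X = bform n B y0 y0" by (simp add: x0_def quadC)
  have feas: "mat_of f \<in> feasible n d C P R \<longleftrightarrow>
      (\<forall>k. psd_form (d k) (\<lambda>a b. f (k, a, b))) \<and> psd_form n (\<lambda>i j. Aop f i j - B i j)" for f
  proof -
    have "psd_form (d k) (\<lambda>a b. mat_of f k $$ (a, b)) \<longleftrightarrow> psd_form (d k) (\<lambda>a b. f (k, a, b))" for k
      by (rule psd_form_cong) (simp add: mat_of_def)
    then have "psd (mat_of f k) \<longleftrightarrow> psd_form (d k) (\<lambda>a b. f (k, a, b))" for k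
      using psd_iff_psd_form[OF mat_of_carrier] by simp
    moreover have "psd (mat_of f k) \<Longrightarrow> mat_of f k \<in> sym_mats (d k)" for k
      using carrier_matD[OF mat_of_carrier[of f k]] by (simp add: psd_def)
    moreover have "loewner_le (transpose_mat P * C * P)
        (Matrix.mat n n (\<lambda>(i, j). \<Sum>k\<in>UNIV. R_adj n (R k) (mat_of f k) $$ (i, j)))
        \<longleftrightarrow> psd_form n (\<lambda>i j. Aop f i j - B i j)"
      by (subst loewner_le_iff_psd_form[OF Mc[unfolded M_def]], simp, rule psd_form_cong)
         (simp add: Aop_eq B_def M_def del: index_mult_mat)
    ultimately show ?thesis unfolding feasible_def by blast
  qed
  define r where "r = 2 * max (ln (2 * real D)) 1"
  obtain f where f: "f \<in> Lset (r * Opt C X)" "psd_form n (\<lambda>i j. Aop f i j - B i j)"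
    and fmin: "\<And>\<gamma> g. g \<in> Lset \<gamma> \<Longrightarrow> psd_form n (\<lambda>i j. Aop g i j - B i j) \<Longrightarrow> phi T (lam f) \<le> phi T (lam g)"
    using relaxation_bound[of B "Opt C X"] B max unfolding r_def D_def opt by blast
  have L0: "mat_of f \<in> feasible n d C P R" using f by (simp add: feas Lset_def)
  have Lmin: "phi T (lam f) \<le> phi T (lambda_vec L)" if L: "L \<in> feasible n d C P R" for L
  proof -
    \<comment> \<open>Every feasible tuple has such an encoding; its own value serves as the level,
      so \<open>fmin\<close> applies to it however large that value is.\<close>
    define g where "g = (\<lambda>(k, a, b). if a < d k \<and> b < d k then L k $$ (a, b) else 0)"
    have Lc: "L k \<in> carrier_mat (d k) (d k)" for k using L by (simp add: feasible_def sym_mats_def)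
    have "mat_of g k = L k" for k
      by (rule eq_matI) (simp_all add: mat_of_def g_def carrier_matD[OF Lc])
    then have gL: "mat_of g = L" by blast
    then have "g \<in> Lset (phi T (lam g))" "psd_form n (\<lambda>i j. Aop g i j - B i j)"
      using L feas[of g] by (auto simp: Lset_def g_def)
    from fmin[OF this] show ?thesis by (simp add: lam_eq gL)
  qed
  have star: "Opt_star n d C P R T = phi T (lam f)"
    unfolding Opt_star_def using L0 Lmin by (intro cInf_eq_minimum) (auto simp: lam_eq)
  have "is_arg_max (quad C) (\<lambda>x. x \<in> X) x0"
    using x0 xmax by (auto simp: is_arg_max_def not_less)
  moreover have "is_arg_min (\<lambda>L. phi T (lambda_vec L)) (\<lambda>L. L \<in> feasible n d C P R) (mat_of f)"
    using L0 Lmin by (auto simp: is_arg_min_def not_less lam_eq[symmetric])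
  moreover have "Opt C X \<le> Opt_star n d C P R T"
    unfolding opt star using f y0 by (intro weak_duality) (auto simp: Lset_def)
  moreover have "Opt_star n d C P R T \<le> r * Opt C X"
    unfolding star using f(1) by (simp add: Lset_def)
  ultimately show ?thesis unfolding r_def by blast
qed

end
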